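(* Fix $\alpha>0$, $M_0>0$, $M>0$ and $\rho>0$. Let $p=p_n$ satisfy $p\ge n^{\frac1{2\alpha+1}}$ and $\log p=o(n)$, and let $\hat\Sigma_k$ denote the tapering estimator of the covariance matrix $\Sigma=\Sigma_{p\times p}$ with tapering parameter $k$. There is a constant $C>0$, independent of $n$, $p$ and $k$, such that for $k=k_n=o(n)$ and all sufficiently large $n$, $$\sup_{\mathcal P_\alpha}\mathbb E\|\hat\Sigma_k-\Sigma\|^2\le C\,\frac{k+\log p}{n}+Ck^{-2\alpha},$$ where $\mathcal P_\alpha=\mathcal P_\alpha(M_0,M,\rho)$. In particular, the estimator $\hat\Sigma=\hat\Sigma_k$ with $k=n^{\frac1{2\alpha+1}}$ satisfies $$\sup_{\mathcal P_\alpha}\mathbb E\|\hat\Sigma-\Sigma\|^2\le Cn^{-\frac{2\alpha}{2\alpha+1}}+C\,\frac{\log p}{n}.$$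
   Context: $\mathbf X_1,\dots,\mathbf X_n$ are i.i.d. random vectors in $\mathbb R^p$ with covariance matrix $\Sigma=(\sigma_{ij})_{1\le i,j\le p}$. For a matrix $A$, $\|A\|=\sup_{\|x\|_2=1}\|Ax\|_2$ is the operator norm. $\Sigma^*=(\sigma^*_{ij})_{1\le i,j\le p}=\frac1n\sum_{l=1}^n(\mathbf X_l-\bar{\mathbf X})(\mathbf X_l-\bar{\mathbf X})^T$, where $\bar{\mathbf X}=\frac1n\sum_{l=1}^n\mathbf X_l$. For an even integer $k$ with $1\le k\le p$, put $k_h=k/2$; the tapering estimator is $\hat\Sigma_k=(w_{ij}\sigma^*_{ij})_{p\times p}$ with weights $w_{ij}=k_h^{-1}\{(k-|i-j|)_+-(k_h-|i-j|)_+\}$; that is, $w_{ij}=1$ if $|i-j|\le k_h$, $w_{ij}=2-|i-j|/k_h$ if $k_h<|i-j|<k$, and $w_{ij}=0$ otherwise. The tapering parameter $k$ is always an even integer with $1\le k\le p$; "$k=n^{1/(2\alpha+1)}$" is read as $n^{1/(2\alpha+1)}$ rounded down to an even integer. $\mathcal F_\alpha(M_0,M)$ is the set of $p\times p$ covariance matrices $\Sigma$ such that $\max_j\sum_{i:\,|i-j|>k}|\sigma_{ij}|\le Mk^{-\alpha}$ for all $k$ (positive integers), and $\lambda_{\max}(\Sigma)\le M_0$, where $\lambda_{\max}$ is the largest eigenvalue. $\mathcal P_\alpha(M_0,M,\rho)$ is the set of distributions of $\mathbf X_1$ on $\mathbb R^p$ whose covariance matrix lies in $\mathcal F_\alpha(M_0,M)$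 and which are sub-Gaussian in the sense that $\mathbb P\{|\mathbf v^T(\mathbf X_1-\mathbb E\mathbf X_1)|>t\}\le e^{-t^2\rho/2}$ for all $t>0$ and all $\|\mathbf v\|_2=1$. *)

theory Defs
  imports
    "HOL-Probability.Probability"
    "HOL-Library.Landau_Symbols"
    "Jordan_Normal_Form.Spectral_Radius"
begin

unbundle no inner_syntax

(* The dimension p varies with n, so it cannot be a type.  A point of R^p is a function
   nat => real in the product space over the index set {..<p}; vectors and matrices in the
   algebraic sense are "real vec" and "real mat".  Indices run over 0,...,p-1, which does not
   affect differences of indices. *)

definition Rp :: "nat \<Rightarrow> (nat \<Rightarrow> real) measure" where
  "Rp p = PiM {..<p} (\<lambda>_. borel)"

text \<open>The laws of random vectors in \<open>R^p\<close> that have a covariance matrix.\<close>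

definition L2_laws :: "nat \<Rightarrow> (nat \<Rightarrow> real) measure set" where
  "L2_laws p = {P. prob_space P \<and> sets P = sets (Rp p) \<and>
     (\<forall>i<p. integrable P (\<lambda>x. (x i)\<^sup>2))}"

definition mean_vec :: "nat \<Rightarrow> (nat \<Rightarrow> real) measure \<Rightarrow> real vec" where
  "mean_vec p P = vec p (\<lambda>i. \<integral>x. x i \<partial>P)"

definition cov_mat :: "nat \<Rightarrow> (nat \<Rightarrow> real) measure \<Rightarrow> real mat" where
  "cov_mat p P = mat p p (\<lambda>(i, j).
     \<integral>x. (x i - mean_vec p P $ i) * (x j - mean_vec p P $ j) \<partial>P)"

definition l2_norm :: "real vec \<Rightarrow> real" where
  "l2_norm v = sqrt (v \<bullet> v)"

definition op_norm :: "real mat \<Rightarrow> real" where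
  "op_norm A = (SUP v \<in> {v \<in> carrier_vec (dim_col A). l2_norm v = 1}. l2_norm (A *\<^sub>v v))"

text \<open>Applied to symmetric matrices of positive size only, whose spectrum over the reals is
  finite and non-empty.\<close>

definition lambda_max :: "real mat \<Rightarrow> real" where
  "lambda_max A = Max (spectrum A)"

definition F_class :: "nat \<Rightarrow> real \<Rightarrow> real \<Rightarrow> real \<Rightarrow> real mat set" where
  "F_class p \<alpha> M0 M = {S \<in> cov_mat p ` L2_laws p.
     (\<forall>k::nat. k \<ge> 1 \<longrightarrow>
        (MAX j\<in>{..<p}. \<Sum>i | i < p \<and> \<bar>int i - int j\<bar> > int k. \<bar>S $$ (i, j)\<bar>)
          \<le> M * real k powr (- \<alpha>)) \<and>
     lambda_max S \<le> M0}"

definition sub_gaussian :: "nat \<Rightarrow> real \<Rightarrow> (nat \<Rightarrow> real) measure \<Rightarrow> bool" where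
  "sub_gaussian p \<rho> P \<longleftrightarrow>
     (\<forall>t>0. \<forall>v\<in>carrier_vec p. l2_norm v = 1 \<longrightarrow>
        measure P {x \<in> space P. \<bar>v \<bullet> (vec p x - mean_vec p P)\<bar> > t} \<le> exp (- (t\<^sup>2 * \<rho> / 2)))"

definition P_class :: "nat \<Rightarrow> real \<Rightarrow> real \<Rightarrow> real \<Rightarrow> real \<Rightarrow> (nat \<Rightarrow> real) measure set" where
  "P_class p \<alpha> M0 M \<rho> =
     {P \<in> L2_laws p. cov_mat p P \<in> F_class p \<alpha> M0 M \<and> sub_gaussian p \<rho> P}"

text \<open>In the following, \<open>x l i\<close> is the \<open>i\<close>-th coordinate of the \<open>l\<close>-th observation, \<open>l < n\<close>.\<close>

definition sample_mean :: "nat \<Rightarrow> (nat \<Rightarrow> nat \<Rightarrow> real) \<Rightarrow> nat \<Rightarrow> real" where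
  "sample_mean n x i = (\<Sum>l<n. x l i) / real n"

definition sample_cov :: "nat \<Rightarrow> nat \<Rightarrow> (nat \<Rightarrow> nat \<Rightarrow> real) \<Rightarrow> real mat" where
  "sample_cov n p x = mat p p (\<lambda>(i, j).
     (\<Sum>l<n. (x l i - sample_mean n x i) * (x l j - sample_mean n x j)) / real n)"

definition taper_weight :: "nat \<Rightarrow> nat \<Rightarrow> nat \<Rightarrow> real" where
  "taper_weight k i j =
     (let kh = real k / 2; d = \<bar>real i - real j\<bar>
      in (max 0 (real k - d) - max 0 (kh - d)) / kh)"

lemma taper_weight_cases:
  assumes "k \<ge> 1"
  shows "taper_weight k i j =
    (if \<bar>real i - real j\<bar> \<le> real k / 2 then 1
     else if \<bar>real i - real j\<bar> < real k then 2 - \<bar>real i - real j\<bar> / (real k / 2)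
     else 0)"
  using assms unfolding taper_weight_def Let_def by (auto simp: max_def field_simps)

definition tapering_estimator :: "nat \<Rightarrow> nat \<Rightarrow> nat \<Rightarrow> (nat \<Rightarrow> nat \<Rightarrow> real) \<Rightarrow> real mat" where
  "tapering_estimator n p k x =
     mat p p (\<lambda>(i, j). taper_weight k i j * sample_cov n p x $$ (i, j))"

(* The observations are i.i.d. with law P, i.e. their joint law is the n-fold product of P;
   the expectation of the squared loss is taken under this joint law, as an integral with values
   in [0,\<infinity>], so that no integrability is presupposed. *)

definition risk :: "nat \<Rightarrow> nat \<Rightarrow> nat \<Rightarrow> (nat \<Rightarrow> real) measure \<Rightarrow> ennreal" where
  "risk n p k P =
     (\<integral>\<^sup>+ x. ennreal ((op_norm (tapering_estimator n p k x - cov_mat p P))\<^sup>2)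
       \<partial>(PiM {..<n} (\<lambda>_. P)))"

definition even_floor :: "real \<Rightarrow> nat" where
  "even_floor y = 2 * nat \<lfloor>y / 2\<rfloor>"

end

(*
For even k = 2h the weight w_ij is 1/h times the number of windows of length k, minus the number of
windows of length h, that contain both i and j. Hence the quadratic form of the tapered error matrix
is at most three times the maximal quadratic form of its restrictions to windows of length k, and a
lattice net reduces each of these to exp (O(k)) vectors v with |v| <= 1.

For such v put Z = v . (X - E X). The form at v of the sample covariance minus the covariance is
mean (Z_l^2 - E Z^2) - (mean Z_l)^2. Since E exp (rho Z^2 / 4) <= 7, both Z and Z^2 - E Z^2 have, after
scaling, moment generating functions below exp (28 t^2) for |t| <= 1/2. With L of order k + log p, a
union bound at the single parameter t = sqrt (L / n) bounds the expected fourth power of the maximal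
mean by a multiple of (L / n)^2. The bias is bounded through its row sums.
*)
theory Submission
  imports Defs "HOL-Real_Asymp.Real_Asymp"
begin

section \<open>Exponential moments\<close>

text \<open>Two obstacles shape the argument. A net of the unit ball of R^p costs exp (O(p))
  vectors, too many when p exceeds n; vectors supported on windows cost only p + k + 1 times exp
  (O(k)), and the logarithm of this is of the order k + log p of L. The moment generating functions
  are controlled only for |t| <= 1/2, so t = sqrt (L / n) is admissible when 4 L <= n, which k =
  o(n) and log p = o(n) guarantee eventually.

  Fourth powers appear because the correction (mean Z_l)^2 for the unknown mean is squared once more
  in the loss. The leading mean D is brought to the fourth power by D^2 <= s / 2 + D^4 / (2 s) with
  s = L / n, so that one estimate serves both. Random quantities are bounded pointwise by a
  measurable majorant and only the majorant is integrated, which avoids the measurability question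
  for the operator norm.

  The scale rho / 4 turns the tail exp (- rho t^2 / 2) of |Z| into the tail exp (- 2 y) of rho Z^2 /
  4, twice the critical rate for a finite exponential moment.\<close>

lemma exp_le_taylor_abs:
  fixes x :: real
  shows "exp x \<le> 1 + x + x\<^sup>2 / 2 * exp \<bar>x\<bar>"
proof -
  obtain t where t: "\<bar>t\<bar> \<le> \<bar>x\<bar>" "exp x = (\<Sum>m<2. x ^ m / fact m) + exp t / fact 2 * x ^ 2"
    using Maclaurin_exp_le[of x 2] by auto
  have "exp t * x\<^sup>2 \<le> exp \<bar>x\<bar> * x\<^sup>2"
    using t(1) by (intro mult_right_mono) auto
  then show ?thesis
    using t(2) by (simp add: numeral_2_eq_2 mult.commute)
qed

text \<open>Since |l| <= 1/2, the Taylor remainder uses only exp (y/2); the other half of exp y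
  absorbs the factor y^2, because y^2 / 8 <= exp (y/2). The linear term stays exact, so that it
  becomes the mean after integration.\<close>

lemma exp_mult_le_nonneg:
  fixes l y :: real
  assumes "\<bar>l\<bar> \<le> 1/2" "0 \<le> y"
  shows "exp (l * y) \<le> 1 + l * y + 4 * l\<^sup>2 * exp y"
proof -
  have "y\<^sup>2 / 2 \<le> 4 * exp (y/2)"
    using exp_lower_Taylor_quadratic[of "y/2"] assms by (simp add: power2_eq_square)
  moreover have "exp \<bar>l * y\<bar> \<le> exp (y/2)"
    using mult_right_mono[of "\<bar>l\<bar>" "1/2" y] assms by (simp add: abs_mult)
  ultimately have "y\<^sup>2 / 2 * exp \<bar>l * y\<bar> \<le> 4 * exp (y/2) * exp (y/2)"
    by (intro mult_mono) auto
  also have "\<dots> = 4 * exp y"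
    by (simp add: mult.assoc flip: exp_add)
  finally have "l\<^sup>2 * (y\<^sup>2 / 2 * exp \<bar>l * y\<bar>) \<le> l\<^sup>2 * (4 * exp y)"
    by (intro mult_left_mono) auto
  then show ?thesis
    using exp_le_taylor_abs[of "l * y"] by (simp add: power_mult_distrib algebra_simps)
qed

text \<open>Counterpart of \<open>exp_mult_le_nonneg\<close> for a variable of either sign: |v| / 2
  <= 1 + v^2 / 2 trades the exponential of |l v| for half of exp (v^2), and the factor v^2 / 2 uses
  up the other half. The constant 4 bounds exp 1.\<close>

lemma exp_mult_le_square:
  fixes l v :: real
  assumes "\<bar>l\<bar> \<le> 1/2"
  shows "exp (l * v) \<le> 1 + l * v + 4 * l\<^sup>2 * exp (v\<^sup>2)"
proof -
  have "v\<^sup>2 / 2 \<le> exp (v\<^sup>2 / 2)"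
    using exp_ge_add_one_self[of "v\<^sup>2 / 2"] by linarith
  moreover have "exp \<bar>l * v\<bar> \<le> 4 * exp (v\<^sup>2 / 2)"
  proof -
    have "0 \<le> (\<bar>v\<bar> - 1/2)\<^sup>2" by simp
    then have "\<bar>v\<bar> / 2 \<le> 1 + v\<^sup>2 / 2"
      by (simp add: power2_diff power_divide)
    then have "\<bar>l * v\<bar> \<le> 1 + v\<^sup>2 / 2"
      using mult_right_mono[OF assms, of "\<bar>v\<bar>"] by (simp add: abs_mult)
    then have "exp \<bar>l * v\<bar> \<le> exp 1 * exp (v\<^sup>2 / 2)"
      by (simp flip: exp_add)
    also have "\<dots> \<le> 4 * exp (v\<^sup>2 / 2)"
      using exp_le by (intro mult_right_mono) auto
    finally show ?thesis .
  qed
  ultimately have "v\<^sup>2 / 2 * exp \<bar>l * v\<bar> \<le> exp (v\<^sup>2 / 2) * (4 * exp (v\<^sup>2 / 2))"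
    by (intro mult_mono) auto
  also have "\<dots> = 4 * exp (v\<^sup>2)"
    by (simp add: mult.assoc mult.left_commute flip: exp_add)
  finally have "l\<^sup>2 * (v\<^sup>2 / 2 * exp \<bar>l * v\<bar>) \<le> l\<^sup>2 * (4 * exp (v\<^sup>2))"
    by (intro mult_left_mono) auto
  then show ?thesis
    using exp_le_taylor_abs[of "l * v"] by (simp add: power_mult_distrib algebra_simps)
qed

text \<open>Up to the level B the fourth power is at most B^4; beyond it the excess d = |y| - B
  satisfies d^4 <= 64 exp (t d) / t^4, and (B + d)^4 <= 8 B^4 + 8 d^4. The factor exp (- t B) is the
  gain that later pays for a union bound.\<close>

lemma power4_le_exp:
  fixes B t y :: real
  assumes "0 \<le> B" "0 < t"
  shows "y ^ 4 \<le> 8 * B ^ 4 + 512 / t ^ 4 * exp (- (t * B)) * exp (t * \<bar>y\<bar>)"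
proof (cases "\<bar>y\<bar> \<le> B")
  case True
  then have "\<bar>y\<bar> ^ 4 \<le> B ^ 4" by (intro power_mono) auto
  then have "y ^ 4 \<le> B ^ 4" by (simp add: power_even_abs)
  moreover have "0 \<le> 512 / t ^ 4 * exp (- (t * B)) * exp (t * \<bar>y\<bar>)" by simp
  moreover have "0 \<le> B ^ 4" by simp
  ultimately show ?thesis by linarith
next
  case False
  define d where "d = \<bar>y\<bar> - B"
  have d: "0 \<le> d" using False by (simp add: d_def)
  have td: "0 \<le> t * d" using d assms by simp
  have "(t * d / 2)\<^sup>2 / 2 \<le> exp (t * d / 2)"
    using exp_lower_Taylor_quadratic[of "t * d / 2"] td by linarith
  then have "((t * d / 2)\<^sup>2 / 2)\<^sup>2 \<le> (exp (t * d / 2))\<^sup>2"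
    by (intro power_mono) auto
  also have "\<dots> = exp (t * d)"
    by (simp add: power2_eq_square flip: exp_add)
  finally have "t ^ 4 * d ^ 4 \<le> 64 * exp (t * d)"
    by (simp add: power_divide power_mult_distrib flip: power_mult)
  then have "d ^ 4 \<le> 64 / t ^ 4 * exp (t * d)"
    using assms by (simp add: field_simps)
  also have "exp (t * d) = exp (- (t * B)) * exp (t * \<bar>y\<bar>)"
    by (simp add: d_def algebra_simps flip: exp_add)
  finally have 1: "d ^ 4 \<le> 64 / t ^ 4 * exp (- (t * B)) * exp (t * \<bar>y\<bar>)"
    by (simp add: mult.assoc)
  have sq: "(u + v)\<^sup>2 \<le> 2 * u\<^sup>2 + 2 * v\<^sup>2" for u v :: real
    using zero_le_power2[of "u - v"] by (simp add: power2_eq_square algebra_simps)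
  have "y ^ 4 = ((B + d)\<^sup>2)\<^sup>2"
    by (simp add: d_def power_even_abs flip: power_mult)
  also have "\<dots> \<le> (2 * B\<^sup>2 + 2 * d\<^sup>2)\<^sup>2"
    by (intro power_mono sq) auto
  also have "\<dots> \<le> 2 * (2 * B\<^sup>2)\<^sup>2 + 2 * (2 * d\<^sup>2)\<^sup>2"
    by (rule sq)
  also have "\<dots> = 8 * B ^ 4 + 8 * d ^ 4"
    by (simp add: power_mult_distrib flip: power_mult)
  finally show ?thesis using 1 by linarith
qed

text \<open>The value exp Y is at most 1 plus the sum of exp (m + 1) over the naturals m < Y. The
  assumed tail turns this into a geometric series of ratio exp (- 1), whose sum e / (1 - 1/e) is at
  most 3 * 2.\<close>

lemma nn_integral_exp_le:
  fixes Y :: "'a \<Rightarrow> real"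
  assumes "prob_space P" and [measurable]: "Y \<in> borel_measurable P"
    and tail: "\<And>s. 0 < s \<Longrightarrow> measure P {x \<in> space P. Y x > s} \<le> exp (- 2 * s)"
  shows "(\<integral>\<^sup>+ x. ennreal (exp (Y x)) \<partial>P) \<le> 7"
proof -
  interpret prob_space P by fact
  have bnd: "ennreal (exp (Y x)) \<le> 1 + (\<Sum>m. ennreal (exp (real m + 1)) * indicator {x \<in> space P. Y x > real m} x)"
    if x: "x \<in> space P" for x
  proof (cases "Y x \<le> 0")
    case True
    then have "ennreal (exp (Y x)) \<le> 1" by simp
    then show ?thesis by (simp add: add_increasing2)
  next
    case False
    \<comment> \<open>Ceiling minus one, not the floor: the events are strict, so
      \<open>m < Y x\<close> must hold at integer values too.\<close>
    define m where "m = nat (\<lceil>Y x\<rceil> - 1)"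
    have m: "real m < Y x" "Y x \<le> real m + 1"
      using False unfolding m_def by linarith+
    have "ennreal (exp (Y x)) \<le> ennreal (exp (real m + 1)) * indicator {x \<in> space P. Y x > real m} x"
      using m x by simp
    also have "\<dots> \<le> (\<Sum>m. ennreal (exp (real m + 1)) * indicator {x \<in> space P. Y x > real m} x)"
      using sum_le_suminf[of "\<lambda>m. ennreal (exp (real m + 1)) * indicator {x \<in> space P. Y x > real m} x" "{m}"]
      by (simp del: sum_mult_indicator)
    finally show ?thesis by (simp add: add_increasing)
  qed
  have sm: "(\<lambda>m. exp 1 * exp (- 1) ^ m) sums (exp 1 * (1 / (1 - exp (- 1 :: real))))"
    by (intro sums_mult geometric_sums) simp
  have nn: "0 \<le> exp 1 * exp (- 1 :: real) ^ m" for m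
    by simp
  have "(\<integral>\<^sup>+ x. ennreal (exp (Y x)) \<partial>P)
      \<le> (\<integral>\<^sup>+ x. 1 + (\<Sum>m. ennreal (exp (real m + 1)) * indicator {x \<in> space P. Y x > real m} x) \<partial>P)"
    by (intro nn_integral_mono bnd)
  also have "\<dots> = 1 + (\<Sum>m. ennreal (exp (real m + 1)) * emeasure P {x \<in> space P. Y x > real m})"
    by (subst nn_integral_add, simp, measurable)
       (simp add: nn_integral_suminf nn_integral_cmult emeasure_space_1)
  also have "\<dots> \<le> 1 + (\<Sum>m. ennreal (exp 1 * exp (- 1) ^ m))"
  proof (intro add_left_mono suminf_le)
    fix m
    \<comment> \<open>\<open>tail\<close> speaks of positive levels only; at m = 0 the bound is the
      trivial 1.\<close>
    have "measure P {x \<in> space P. Y x > real m} \<le> exp (- 2 * real m)"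
      using tail[of m] by (cases "m = 0") auto
    then have "ennreal (exp (real m + 1)) * emeasure P {x \<in> space P. Y x > real m}
        \<le> ennreal (exp (real m + 1)) * ennreal (exp (- 2 * real m))"
      by (intro mult_left_mono) (auto simp: emeasure_eq_measure)
    also have "\<dots> = ennreal (exp 1 * exp (- 1) ^ m)"
      by (simp add: exp_of_nat_mult[symmetric] flip: exp_add ennreal_mult')
    finally show "ennreal (exp (real m + 1)) * emeasure P {x \<in> space P. Y x > real m} \<le> ennreal (exp 1 * exp (- 1) ^ m)" .
  qed auto
  also have "\<dots> = 1 + ennreal (exp 1 * (1 / (1 - exp (- 1))))"
    unfolding suminf_ennreal2[OF nn sums_summable[OF sm]] sums_unique[OF sm, symmetric] ..
  also have "\<dots> \<le> 1 + ennreal 6"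
  proof (intro add_left_mono ennreal_leI)
    have "2 \<le> exp (1::real)" using exp_ge_add_one_self[of 1] by simp
    then have "exp (-1::real) \<le> 1/2" by (simp add: exp_minus field_simps)
    then have "1 / (1 - exp (-1::real)) \<le> 2" by (simp add: field_simps)
    then have "exp 1 * (1 / (1 - exp (- 1))) \<le> 3 * (2::real)"
      using exp_le \<open>exp (-1::real) \<le> 1/2\<close> by (intro mult_mono) auto
    then show "exp 1 * (1 / (1 - exp (- 1))) \<le> (6::real)" by simp
  qed
  also have "\<dots> = ennreal (1 + 6)"
    by (subst ennreal_plus) auto
  also have "\<dots> = 7"
    by simp
  finally show ?thesis .
qed

text \<open>Integrating \<open>le\<close> gives at most 1 + l m + 28 l^2, with 28 = 4 * 7, hence at
  most exp (l m + 28 l^2); dividing by exp (l m) centres f. Thus the pointwise bound concerns f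
  itself and not f - m.\<close>

lemma mgf_le:
  fixes f g :: "'a \<Rightarrow> real"
  assumes "prob_space P" and f: "integrable P f" "(\<integral>x. f x \<partial>P) = m"
    and [measurable]: "g \<in> borel_measurable P"
    and g: "(\<integral>\<^sup>+ x. ennreal (exp (g x)) \<partial>P) \<le> 7"
    and le: "\<And>x. exp (l * f x) \<le> 1 + l * f x + 4 * l\<^sup>2 * exp (g x)"
  shows "(\<integral>\<^sup>+ x. ennreal (exp (l * (f x - m))) \<partial>P) \<le> ennreal (exp (28 * l\<^sup>2))"
proof -
  interpret prob_space P by fact
  note [measurable] = borel_measurable_integrable[OF f(1)]
  have ig: "integrable P (\<lambda>x. exp (g x))"
    by (rule integrableI_nonneg) (use g in \<open>auto simp: less_top[symmetric] top_unique\<close>)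
  have eg: "(\<integral>x. exp (g x) \<partial>P) \<le> 7"
    using g nn_integral_eq_integral[OF ig] by (simp add: ennreal_le_iff2 flip: ennreal_numeral)
  have ie: "integrable P (\<lambda>x. exp (l * f x))"
    by (rule Bochner_Integration.integrable_bound[where f="\<lambda>x. 1 + l * f x + 4 * l\<^sup>2 * exp (g x)"])
       (use f ig le in \<open>auto intro!: Bochner_Integration.integrable_add integrable_mult_right AE_I2 order.trans[OF le abs_ge_self]\<close>)
  have "(\<integral>x. exp (l * f x) \<partial>P) \<le> (\<integral>x. 1 + l * f x + 4 * l\<^sup>2 * exp (g x) \<partial>P)"
    using f ig ie le by (intro integral_mono) auto
  also have "\<dots> = 1 + l * m + 4 * l\<^sup>2 * (\<integral>x. exp (g x) \<partial>P)"
    using f ig by (simp add: prob_space)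
  also have "\<dots> \<le> 1 + (l * m + 28 * l\<^sup>2)"
    using mult_left_mono[OF eg, of "4 * l\<^sup>2"] by simp
  also have "\<dots> \<le> exp (l * m + 28 * l\<^sup>2)"
    by (rule exp_ge_add_one_self)
  finally have *: "(\<integral>x. exp (l * f x) \<partial>P) \<le> exp (l * m + 28 * l\<^sup>2)" .
  have "(\<integral>\<^sup>+ x. ennreal (exp (l * (f x - m))) \<partial>P) = (\<integral>\<^sup>+ x. ennreal (exp (- l * m)) * ennreal (exp (l * f x)) \<partial>P)"
    by (simp add: algebra_simps flip: exp_add ennreal_mult')
  also have "\<dots> = ennreal (exp (- l * m)) * ennreal (\<integral>x. exp (l * f x) \<partial>P)"
    using ie by (simp add: nn_integral_cmult nn_integral_eq_integral)
  also have "\<dots> \<le> ennreal (exp (- l * m)) * ennreal (exp (l * m + 28 * l\<^sup>2))"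
    by (intro mult_left_mono ennreal_leI *) auto
  also have "\<dots> = ennreal (exp (28 * l\<^sup>2))"
    by (simp flip: exp_add ennreal_mult')
  finally show ?thesis .
qed

text \<open>\<open>power4_le_exp\<close> turns fourth powers into exponentials at one parameter, a
  maximum over \<open>I\<close> is replaced by the sum over \<open>I\<close> and both signs (hence
  \<open>2 * real (card I)\<close>), and independence factorizes the exponential of a sum. The bound
  \<open>4 * L \<le> real n\<close> keeps \<open>l = sqrt (L / n)\<close> within 1/2. One majorant
  \<open>G\<close> serves all \<open>i\<close> at once, so it also dominates the maximum.\<close>

lemma average_fourth_moment:
  fixes f :: "'i \<Rightarrow> 'a \<Rightarrow> real" and L :: real
  assumes "prob_space P" and "finite I"
    and meas: "\<And>i. i \<in> I \<Longrightarrow> f i \<in> borel_measurable P"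
    and mgf: "\<And>i l. i \<in> I \<Longrightarrow> \<bar>l\<bar> \<le> 1/2 \<Longrightarrow>
      (\<integral>\<^sup>+ x. ennreal (exp (l * f i x)) \<partial>P) \<le> ennreal (exp (28 * l\<^sup>2))"
    and card: "2 * real (card I) \<le> exp L" and L: "1 \<le> L" "4 * L \<le> real n"
  shows "\<exists>G \<in> borel_measurable (PiM {..<n} (\<lambda>_. P)).
    (\<forall>x. \<forall>i\<in>I. ennreal (((\<Sum>l<n. f i (x l)) / real n) ^ 4) \<le> G x) \<and>
    (\<integral>\<^sup>+ x. G x \<partial>PiM {..<n} (\<lambda>_. P)) \<le> ennreal (6000000 * (L / real n)\<^sup>2)"
proof -
  interpret prob_space P by fact
  interpret PP: product_sigma_finite "\<lambda>_::nat. P"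
    by (simp add: product_sigma_finite_def sigma_finite_measure_axioms)
  let ?Q = "PiM {..<n} (\<lambda>_. P)"
  interpret Q: prob_space ?Q
    by (rule prob_space_PiM) (rule prob_space_axioms)
  have n: "0 < real n" using L by linarith
  (* t makes the union bound over I and the moment generating functions cost the same, both of order exp L;
     B is chosen so that exp (- t * B) cancels them exactly. *)
  define l where "l = sqrt (L / n)"
  define t where "t = real n * l"
  define B where "B = 29 * L / t"
  define K where "K = 512 / t ^ 4 * exp (- (t * B))"
  have l: "0 < l" "\<bar>l\<bar> \<le> 1/2" and l2: "l\<^sup>2 = L / n"
  proof -
    show "0 < l" using n L by (simp add: l_def)
    have "L / n \<le> (1/2)\<^sup>2" using L n by (simp add: power2_eq_square field_simps)
    then have "l \<le> 1/2" unfolding l_def by (intro real_le_lsqrt) auto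
    then show "\<bar>l\<bar> \<le> 1/2" using \<open>0 < l\<close> by simp
    show "l\<^sup>2 = L / n" using L n by (simp add: l_def)
  qed
  have t: "0 < t" using l n by (simp add: t_def)
  have t2: "t\<^sup>2 = n * L" using n by (simp add: t_def power_mult_distrib l2) (simp add: power2_eq_square)
  have "t ^ 4 = (t\<^sup>2)\<^sup>2" by (simp flip: power_mult)
  then have t4: "t ^ 4 = (n * L)\<^sup>2" by (simp only: t2)
  have B: "0 \<le> B" using L t by (simp add: B_def)
  have tB: "t * B = 29 * L" using t by (simp add: B_def)
  have K: "0 \<le> K" by (simp add: K_def)
  define g where "g s i x = (\<Prod>j<n. ennreal (exp (s * f i (x j))))" for s i and x :: "nat \<Rightarrow> 'a"
  have g_eq: "g s i x = ennreal (exp (s * (\<Sum>j<n. f i (x j))))" for s i x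
    by (simp add: g_def prod_ennreal exp_sum sum_distrib_left)
  define G where "G x = ennreal (8 * B ^ 4) + (\<Sum>i\<in>I. ennreal K * (g l i x + g (- l) i x))" for x
  have fm[measurable]: "(\<lambda>x. f i (x j)) \<in> borel_measurable ?Q" if "i \<in> I" "j \<in> {..<n}" for i j
    using meas[OF that(1)] that(2) by measurable
  have gm: "g s i \<in> borel_measurable ?Q" if "i \<in> I" for s i
    unfolding g_eq[abs_def] using fm[OF that] by measurable
  have g_int: "(\<integral>\<^sup>+ x. g s i x \<partial>?Q) \<le> ennreal (exp (28 * L))" if "i \<in> I" "\<bar>s\<bar> = \<bar>l\<bar>" for s i
  proof -
    have s2: "s\<^sup>2 = L / n" using that(2) l2 by (metis power2_abs)
    have "(\<integral>\<^sup>+ x. g s i x \<partial>?Q) = (\<Prod>j<n. (\<integral>\<^sup>+ x. ennreal (exp (s * f i x)) \<partial>P))"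
      unfolding g_def using meas[OF that(1)]
      by (intro PP.product_nn_integral_prod) auto
    also have "\<dots> \<le> (\<Prod>j<n. ennreal (exp (28 * s\<^sup>2)))"
      using that l by (intro prod_mono_ennreal) (auto intro!: mgf)
    also have "\<dots> = ennreal (exp (real n * (28 * s\<^sup>2)))"
      by (simp add: ennreal_power exp_of_nat_mult)
    also have "real n * (28 * s\<^sup>2) = 28 * L"
      using n s2 by simp
    finally show ?thesis .
  qed
  show ?thesis
  proof (intro bexI[of _ G] conjI allI ballI)
    show "G \<in> borel_measurable ?Q"
      unfolding G_def using gm by measurable
    fix x i assume i: "i \<in> I"
    define y where "y = (\<Sum>l<n. f i (x l)) / real n"
    have "t * \<bar>y\<bar> = l * \<bar>\<Sum>l<n. f i (x l)\<bar>"
      using n by (simp add: y_def t_def)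
    then have "exp (t * \<bar>y\<bar>) \<le> exp (l * (\<Sum>l<n. f i (x l))) + exp (- l * (\<Sum>l<n. f i (x l)))"
      by (cases "0 \<le> (\<Sum>l<n. f i (x l))") (auto simp: add_increasing add_increasing2)
    then have "ennreal (K * exp (t * \<bar>y\<bar>)) \<le> ennreal K * (g l i x + g (- l) i x)"
      unfolding g_eq using K by (subst ennreal_plus[symmetric], simp, simp, subst ennreal_mult[symmetric])
        (auto intro!: ennreal_leI mult_left_mono)
    also have "\<dots> \<le> (\<Sum>i\<in>I. ennreal K * (g l i x + g (- l) i x))"
      using \<open>finite I\<close> i by (intro member_le_sum) auto
    finally have "ennreal (8 * B ^ 4) + ennreal (K * exp (t * \<bar>y\<bar>)) \<le> G x"
      unfolding G_def by (intro add_left_mono)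
    moreover have "ennreal (y ^ 4) \<le> ennreal (8 * B ^ 4 + K * exp (t * \<bar>y\<bar>))"
      using power4_le_exp[OF B t, of y] by (intro ennreal_leI) (simp add: K_def)
    ultimately show "ennreal (y ^ 4) \<le> G x"
      using B K by (simp add: ennreal_plus)
  next
    have int_G: "(\<integral>\<^sup>+ x. G x \<partial>?Q) = ennreal (8 * B ^ 4) + (\<integral>\<^sup>+ x. (\<Sum>i\<in>I. ennreal K * (g l i x + g (- l) i x)) \<partial>?Q)"
      unfolding G_def using gm by (subst nn_integral_add) (auto simp: Q.emeasure_space_1)
    have "exp L * K * exp (28 * L) = 512 / (n * L)\<^sup>2"
    proof -
      have "exp L * K * exp (28 * L) = 512 / (n * L)\<^sup>2 * (exp L * exp (- (29 * L)) * exp (28 * L))"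
        unfolding K_def tB t4 by (simp only: mult_ac)
      also have "exp L * exp (- (29 * L)) * exp (28 * L) = 1"
        by (simp flip: exp_add)
      finally show ?thesis by simp
    qed
    \<comment> \<open>Amounts to 1 <= L^4.\<close>
    also have "\<dots> \<le> 512 * (L / n)\<^sup>2"
    proof -
      have "1 \<le> L ^ 4" using L by simp
      then show ?thesis using n L by (simp add: field_simps power2_eq_square power4_eq_xxxx)
    qed
    finally have exp_K: "exp L * K * exp (28 * L) \<le> 512 * (L / n)\<^sup>2" .
    have "(\<integral>\<^sup>+ x. (\<Sum>i\<in>I. ennreal K * (g l i x + g (- l) i x)) \<partial>?Q)
        = (\<Sum>i\<in>I. ennreal K * ((\<integral>\<^sup>+ x. g l i x \<partial>?Q) + (\<integral>\<^sup>+ x. g (- l) i x \<partial>?Q)))"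
      using gm by (subst nn_integral_sum) (auto simp: nn_integral_cmult nn_integral_add)
    also have "\<dots> \<le> (\<Sum>i\<in>I. ennreal K * (ennreal (exp (28 * L)) + ennreal (exp (28 * L))))"
      by (intro sum_mono mult_left_mono add_mono g_int) auto
    also have "\<dots> = ennreal (2 * real (card I) * K * exp (28 * L))"
      using K by (simp add: ennreal_of_nat_eq_real_of_nat mult_ac flip: ennreal_plus ennreal_mult')
    also have "\<dots> \<le> ennreal (exp L * K * exp (28 * L))"
      using card K by (intro ennreal_leI mult_right_mono) auto
    also have "\<dots> \<le> ennreal (512 * (L / n)\<^sup>2)"
      by (rule ennreal_leI[OF exp_K])
    finally have int_sum: "(\<integral>\<^sup>+ x. (\<Sum>i\<in>I. ennreal K * (g l i x + g (- l) i x)) \<partial>?Q) \<le> ennreal (512 * (L / n)\<^sup>2)" .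
    have B4: "8 * B ^ 4 = 8 * 29 ^ 4 * (L / n)\<^sup>2"
      unfolding B_def power_divide power_mult_distrib t4 using n L
      by (simp add: field_simps power2_eq_square power4_eq_xxxx)
    have "(\<integral>\<^sup>+ x. G x \<partial>?Q) \<le> ennreal (8 * 29 ^ 4 * (L / n)\<^sup>2) + ennreal (512 * (L / n)\<^sup>2)"
      unfolding int_G B4 by (rule add_left_mono[OF int_sum])
    also have "\<dots> = ennreal ((8 * 29 ^ 4 + 512) * (L / n)\<^sup>2)"
      by (simp add: algebra_simps flip: ennreal_plus)
    \<comment> \<open>8 * 29^4 + 512 = 5658760.\<close>
    also have "\<dots> \<le> ennreal (6000000 * (L / n)\<^sup>2)"
      by (intro ennreal_leI mult_right_mono) auto
    finally show "(\<integral>\<^sup>+ x. G x \<partial>?Q) \<le> ennreal (6000000 * (L / n)\<^sup>2)" .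
  qed
qed

section \<open>Finite nets of Euclidean balls\<close>

lemma sum_half_power_abs: "(\<Sum>z\<in>{- int m..int m}. (1/2 :: real) ^ nat \<bar>z\<bar>) = 3 - 2 * (1/2) ^ m"
proof (induction m)
  case (Suc m)
  have "{- int (Suc m)..int (Suc m)} = insert (- int (Suc m)) (insert (int (Suc m)) {- int m..int m})"
    by auto
  then show ?case using Suc by (simp add: nat_add_distrib)
qed simp

lemma card_int_l1_ball:
  assumes "finite W"
  shows "card {z \<in> W \<rightarrow>\<^sub>E {- int m..int m}. (\<Sum>i\<in>W. nat \<bar>z i\<bar>) \<le> m} \<le> 3 ^ card W * 2 ^ m"
proof -
  (* Each z in the ball has weight at least 2^-m under the product weight 2^-|z_i|, whose total mass is at most 3^(card W). *)
  let ?S = "{z \<in> W \<rightarrow>\<^sub>E {- int m..int m}. (\<Sum>i\<in>W. nat \<bar>z i\<bar>) \<le> m}"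
  have fin: "finite (W \<rightarrow>\<^sub>E {- int m..int m})" using assms by (intro finite_PiE) auto
  have "real (card ?S) * (1/2) ^ m = (\<Sum>z\<in>?S. (1/2) ^ m)" by simp
  also have "\<dots> \<le> (\<Sum>z\<in>?S. (1/2) ^ (\<Sum>i\<in>W. nat \<bar>z i\<bar>))"
    by (intro sum_mono power_decreasing) auto
  also have "\<dots> \<le> (\<Sum>z\<in>W \<rightarrow>\<^sub>E {- int m..int m}. (1/2) ^ (\<Sum>i\<in>W. nat \<bar>z i\<bar>))"
    using fin by (intro sum_mono2) auto
  also have "\<dots> = (\<Prod>i\<in>W. \<Sum>z\<in>{- int m..int m}. (1/2) ^ nat \<bar>z\<bar>)"
    using assms by (subst prod_sum_PiE) (auto simp: power_sum)
  also have "\<dots> \<le> (\<Prod>i\<in>W. 3)"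
    by (intro prod_mono conjI sum_nonneg) (auto simp: sum_half_power_abs)
  finally have "real (card ?S) \<le> real (3 ^ card W * 2 ^ m)"
    by (simp add: field_simps)
  then show ?thesis by (simp only: of_nat_le_iff)
qed

text \<open>Take the points of the lattice of mesh 1/s, s^2 = 16 k, in the unit ball: rounding errs
  by at most 1/s in each of at most k coordinates, so by k / (16 k) in squared norm. An integer
  vector with sum of squares at most 16 k has l1 norm at most 16 k, since |z| <= z^2 for integers;
  counting the l1 ball gives 3^k 2^(16 k) = 196608^k. Net vectors vanish outside \<open>W\<close>,
  so that they serve on the full index set as well.\<close>

lemma exists_finite_net:
  fixes W :: "'a set"
  assumes W: "finite W" "card W \<le> k" and k: "1 \<le> k"
  shows "\<exists>V. finite V \<and> card V \<le> 196608 ^ k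
    \<and> (\<forall>v\<in>V. (\<forall>i. i \<notin> W \<longrightarrow> v i = 0) \<and> (\<Sum>i\<in>W. (v i)\<^sup>2) \<le> 1)
    \<and> (\<forall>u :: 'a \<Rightarrow> real. (\<Sum>i\<in>W. (u i)\<^sup>2) \<le> 1 \<longrightarrow> (\<exists>v\<in>V. (\<Sum>i\<in>W. (u i - v i)\<^sup>2) \<le> 1/16))"
proof -
  define m where "m = 16 * k"
  define s where "s = 4 * sqrt (real k)"
  have s: "0 < s" "s\<^sup>2 = real m" using k by (auto simp: s_def m_def power_mult_distrib)
  define S where "S = {z \<in> W \<rightarrow>\<^sub>E {- int m..int m}. (\<Sum>i\<in>W. nat \<bar>z i\<bar>) \<le> m}"
  define h where "h z = (\<lambda>i. if i \<in> W then of_int (z i) / s else 0)" for z :: "'a \<Rightarrow> int"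
  define V where "V = {v \<in> h ` S. (\<Sum>i\<in>W. (v i)\<^sup>2) \<le> 1}"
  have finS: "finite S"
    unfolding S_def using W
    by (intro finite_subset[OF _ finite_PiE[of W "\<lambda>_. {- int m..int m}"]]) auto
  have "card V \<le> card (h ` S)"
    unfolding V_def using finS by (intro card_mono) auto
  also have "\<dots> \<le> card S" by (rule card_image_le[OF finS])
  also have "\<dots> \<le> 3 ^ card W * 2 ^ m" unfolding S_def by (rule card_int_l1_ball[OF W(1)])
  also have "\<dots> \<le> 3 ^ k * 2 ^ m" using W by (intro mult_right_mono power_increasing) auto
  also have "\<dots> = 196608 ^ k" by (simp add: m_def power_mult flip: power_mult_distrib)
  finally have card: "card V \<le> 196608 ^ k" .
  have net: "\<exists>v\<in>V. (\<Sum>i\<in>W. (u i - v i)\<^sup>2) \<le> 1/16" if u: "(\<Sum>i\<in>W. (u i)\<^sup>2) \<le> 1" for u :: "'a \<Rightarrow> real"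
  proof -
    (* Rounding towards 0 keeps the net inside the ball and still moves each coordinate by at most 1 / s. *)
    define z where "z = restrict (\<lambda>i. if 0 \<le> u i then \<lfloor>s * u i\<rfloor> else - \<lfloor>- (s * u i)\<rfloor>) W"
    have z: "\<bar>real_of_int (z i)\<bar> \<le> s * \<bar>u i\<bar>" "\<bar>s * u i - z i\<bar> \<le> 1" if "i \<in> W" for i
    proof -
      show "\<bar>s * u i - z i\<bar> \<le> 1" using that by (simp add: z_def) linarith
      show "\<bar>real_of_int (z i)\<bar> \<le> s * \<bar>u i\<bar>"
      proof (cases "0 \<le> u i")
        case True
        then have "0 \<le> s * u i" using s by simp
        then show ?thesis using that True by (simp add: z_def)
      next
        case False
        then have "0 \<le> - (s * u i)" using s by (simp add: mult_nonneg_nonpos)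
        then have "0 \<le> \<lfloor>- (s * u i)\<rfloor>" by simp
        then show ?thesis using that False of_int_floor_le[of "- (s * u i)"] by (simp add: z_def)
      qed
    qed
    have zsq: "(real_of_int (z i))\<^sup>2 \<le> s\<^sup>2 * (u i)\<^sup>2" if "i \<in> W" for i
      using power_mono[OF z(1)[OF that], of 2] by (simp add: power_mult_distrib)
    have "(\<Sum>i\<in>W. (real_of_int (z i))\<^sup>2) \<le> (\<Sum>i\<in>W. s\<^sup>2 * (u i)\<^sup>2)"
      by (intro sum_mono zsq)
    also have "\<dots> \<le> s\<^sup>2" using u s by (simp add: mult_left_le flip: sum_distrib_left)
    finally have zs: "(\<Sum>i\<in>W. (real_of_int (z i))\<^sup>2) \<le> s\<^sup>2" .
    have "real (\<Sum>i\<in>W. nat \<bar>z i\<bar>) \<le> (\<Sum>i\<in>W. (real_of_int (z i))\<^sup>2)"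
    proof -
      have "\<bar>y\<bar> \<le> y\<^sup>2" for y :: int
        using mult_left_mono[of 1 "\<bar>y\<bar>" "\<bar>y\<bar>"] by (cases "y = 0") (auto simp: power2_eq_square)
      then have "real_of_int \<bar>z i\<bar> \<le> real_of_int ((z i)\<^sup>2)" for i by (simp only: of_int_le_iff)
      then show ?thesis by (auto intro!: sum_mono)
    qed
    then have zm: "(\<Sum>i\<in>W. nat \<bar>z i\<bar>) \<le> m"
      using zs s by linarith
    have "z i \<in> {- int m..int m}" if "i \<in> W" for i
      using member_le_sum[OF that, of "\<lambda>i. nat \<bar>z i\<bar>"] W zm by auto
    moreover have "z \<in> extensional W" by (simp add: z_def)
    ultimately have "z \<in> W \<rightarrow>\<^sub>E {- int m..int m}" by (simp add: PiE_iff)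
    then have zS: "z \<in> S" using zm by (simp add: S_def)
    have "(\<Sum>i\<in>W. (h z i)\<^sup>2) = (\<Sum>i\<in>W. (real_of_int (z i))\<^sup>2) / s\<^sup>2"
      by (simp add: h_def power_divide sum_divide_distrib)
    also have "\<dots> \<le> 1" using zs s by (simp add: divide_le_eq)
    finally have "h z \<in> V" using zS by (simp add: V_def)
    moreover have "(\<Sum>i\<in>W. (u i - h z i)\<^sup>2) \<le> 1/16"
    proof -
      have "(u i - h z i)\<^sup>2 \<le> 1 / real m" if "i \<in> W" for i
      proof -
        have "u i - h z i = (s * u i - z i) / s"
          using s that by (simp add: h_def field_simps)
        then have "(u i - h z i)\<^sup>2 = \<bar>s * u i - z i\<bar>\<^sup>2 / s\<^sup>2" by (simp add: power_divide)
        also have "\<dots> \<le> 1 / s\<^sup>2"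
          using power_mono[OF z(2)[OF that], of 2] by (intro divide_right_mono) auto
        finally show ?thesis using s by simp
      qed
      then have "(\<Sum>i\<in>W. (u i - h z i)\<^sup>2) \<le> real (card W) * (1 / real m)"
        by (rule sum_bounded_above)
      also have "\<dots> \<le> 1/16" using W k by (simp add: m_def field_simps)
      finally show ?thesis .
    qed
    ultimately show ?thesis by blast
  qed
  show ?thesis
    by (rule exI[of _ V]) (use card net finS in \<open>auto simp: V_def h_def\<close>)
qed

section \<open>Quadratic forms and tapering\<close>

text \<open>Forms on functions over an index set instead of matrices: restricting to a window is a
  mere change of \<open>I\<close>.\<close>

definition bilin :: "'a set \<Rightarrow> ('a \<Rightarrow> 'a \<Rightarrow> real) \<Rightarrow> ('a \<Rightarrow> real) \<Rightarrow> ('a \<Rightarrow> real) \<Rightarrow> real" where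
  "bilin I A u v = (\<Sum>i\<in>I. \<Sum>j\<in>I. A i j * u i * v j)"

abbreviation "quad I A u \<equiv> bilin I A u u"

lemma bilin_add_left: "bilin I A (\<lambda>i. u i + w i) v = bilin I A u v + bilin I A w v"
  and bilin_add_right: "bilin I A v (\<lambda>i. u i + w i) = bilin I A v u + bilin I A v w"
  and bilin_diff_left: "bilin I A (\<lambda>i. u i - w i) v = bilin I A u v - bilin I A w v"
  and bilin_diff_right: "bilin I A v (\<lambda>i. u i - w i) = bilin I A v u - bilin I A v w"
  and bilin_scale_left: "bilin I A (\<lambda>i. c * u i) v = c * bilin I A u v"
  and bilin_scale_right: "bilin I A v (\<lambda>i. c * u i) = c * bilin I A v u"
  by (simp_all add: bilin_def algebra_simps sum.distrib sum_subtractf sum_distrib_left)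

lemma bilin_sym:
  assumes "\<And>i j. i \<in> I \<Longrightarrow> j \<in> I \<Longrightarrow> A i j = A j i"
  shows "bilin I A u v = bilin I A v u"
proof -
  have "bilin I A u v = (\<Sum>i\<in>I. \<Sum>j\<in>I. A j i * v j * u i)"
    unfolding bilin_def using assms by (intro sum.cong) (auto simp: mult_ac)
  also have "\<dots> = bilin I A v u" unfolding bilin_def by (rule sum.swap)
  finally show ?thesis .
qed

text \<open>Polarization, 4 b(u, v) = q(u + v) - q(u - v), followed by the parallelogram law. The
  sum of squared norms in place of their product avoids square roots; where it matters, one argument
  is rescaled to balance the two.\<close>

lemma bilin_le_quad_bound:
  assumes sym: "\<And>i j. i \<in> I \<Longrightarrow> j \<in> I \<Longrightarrow> A i j = A j i"
    and bound: "\<And>u. \<bar>quad I A u\<bar> \<le> c * (\<Sum>i\<in>I. (u i)\<^sup>2)"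
  shows "\<bar>bilin I A u v\<bar> \<le> c / 2 * ((\<Sum>i\<in>I. (u i)\<^sup>2) + (\<Sum>i\<in>I. (v i)\<^sup>2))"
proof -
  have "bilin I A v u = bilin I A u v"
    by (rule bilin_sym) (rule sym)
  then have "4 * bilin I A u v = quad I A (\<lambda>i. u i + v i) - quad I A (\<lambda>i. u i - v i)"
    by (simp add: bilin_add_left bilin_add_right bilin_diff_left bilin_diff_right)
  then have "4 * \<bar>bilin I A u v\<bar> \<le> \<bar>quad I A (\<lambda>i. u i + v i)\<bar> + \<bar>quad I A (\<lambda>i. u i - v i)\<bar>"
    by linarith
  also have "\<dots> \<le> c * (\<Sum>i\<in>I. (u i + v i)\<^sup>2) + c * (\<Sum>i\<in>I. (u i - v i)\<^sup>2)"
    by (intro add_mono bound)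
  also have "\<dots> = 2 * c * ((\<Sum>i\<in>I. (u i)\<^sup>2) + (\<Sum>i\<in>I. (v i)\<^sup>2))"
    by (simp add: power2_sum power2_diff sum.distrib sum_subtractf) (simp add: algebra_simps)
  finally show ?thesis by simp
qed

lemma quad_scale: "quad I A (\<lambda>i. c * u i) = c\<^sup>2 * quad I A u"
  by (simp add: bilin_scale_left bilin_scale_right power2_eq_square)

lemma quad_bound_homogeneous:
  assumes I: "finite I"
    and bound: "\<And>u. (\<Sum>i\<in>I. (u i)\<^sup>2) \<le> 1 \<Longrightarrow> \<bar>quad I A u\<bar> \<le> c"
  shows "\<bar>quad I A u\<bar> \<le> c * (\<Sum>i\<in>I. (u i)\<^sup>2)"
proof (cases "(\<Sum>i\<in>I. (u i)\<^sup>2) = 0")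
  case True
  then have "\<forall>i\<in>I. u i = 0" using I by (simp add: sum_nonneg_eq_0_iff)
  then have "quad I A u = 0" by (simp add: bilin_def)
  then show ?thesis using True by simp
next
  case False
  define r where "r = (\<Sum>i\<in>I. (u i)\<^sup>2)"
  have r: "0 < r" using False by (simp add: r_def less_le sum_nonneg)
  have "(\<Sum>i\<in>I. (1 / sqrt r * u i)\<^sup>2) = 1"
    using r by (simp add: power_mult_distrib power_divide r_def flip: sum_divide_distrib)
  then have "\<bar>quad I A (\<lambda>i. 1 / sqrt r * u i)\<bar> \<le> c" by (intro bound) simp
  then show ?thesis
    using r unfolding quad_scale r_def[symmetric] by (simp add: power_divide abs_mult field_simps)
qed

text \<open>With N the supremum over the ball and v a net point within 1/4 of u, the difference q(u)
  - q(v) = b(u - v, u + v) is at most N * 1/4 * 2 = N / 2, hence N <= m + N / 2. Absorbing N / 2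
  presupposes that N is finite, which is why boundedness is shown separately.\<close>

lemma quad_le_twice_net_bound:
  assumes I: "finite I" and sym: "\<And>i j. i \<in> I \<Longrightarrow> j \<in> I \<Longrightarrow> A i j = A j i"
    and V: "\<And>v. v \<in> V \<Longrightarrow> (\<Sum>i\<in>I. (v i)\<^sup>2) \<le> 1"
    and net: "\<And>u. (\<Sum>i\<in>I. (u i)\<^sup>2) \<le> 1 \<Longrightarrow> \<exists>v\<in>V. (\<Sum>i\<in>I. (u i - v i)\<^sup>2) \<le> 1/16"
    and m: "\<And>v. v \<in> V \<Longrightarrow> \<bar>quad I A v\<bar> \<le> m"
  shows "\<bar>quad I A u\<bar> \<le> 2 * m * (\<Sum>i\<in>I. (u i)\<^sup>2)"
proof -
  define U where "U = {u :: 'a \<Rightarrow> real. (\<Sum>i\<in>I. (u i)\<^sup>2) \<le> 1}"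
  define N where "N = (SUP u\<in>U. \<bar>quad I A u\<bar>)"
  have bdd: "bdd_above ((\<lambda>u. \<bar>quad I A u\<bar>) ` U)"
  proof (rule bdd_aboveI2)
    fix u assume "u \<in> U"
    then have u: "\<bar>u i\<bar> \<le> 1" if "i \<in> I" for i
      using member_le_sum[OF that, of "\<lambda>i. (u i)\<^sup>2"] I by (auto simp: U_def simp flip: abs_square_le_1)
    have "\<bar>quad I A u\<bar> \<le> (\<Sum>i\<in>I. \<Sum>j\<in>I. \<bar>A i j * u i * u j\<bar>)"
      unfolding bilin_def by (intro order.trans[OF sum_abs] sum_mono sum_abs)
    also have "\<dots> \<le> (\<Sum>i\<in>I. \<Sum>j\<in>I. \<bar>A i j\<bar>)"
      using u by (intro sum_mono) (auto simp: abs_mult intro!: mult_left_le mult_le_one order.trans[OF mult_left_le])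
    finally show "\<bar>quad I A u\<bar> \<le> (\<Sum>i\<in>I. \<Sum>j\<in>I. \<bar>A i j\<bar>)" .
  qed
  have N: "\<bar>quad I A u\<bar> \<le> N * (\<Sum>i\<in>I. (u i)\<^sup>2)" for u
    by (rule quad_bound_homogeneous[OF I]) (auto simp: N_def U_def intro!: cSUP_upper bdd[unfolded U_def])
  have "(\<lambda>_. 0) \<in> U" by (simp add: U_def)
  then have N0: "0 \<le> N"
    using N_def cSUP_upper[OF _ bdd, of "\<lambda>_. 0"] by (simp add: bilin_def)
  have "\<bar>quad I A u\<bar> \<le> m + N / 2" if u: "u \<in> U" for u
  proof -
    obtain v where v: "v \<in> V" "(\<Sum>i\<in>I. (u i - v i)\<^sup>2) \<le> 1/16"
      using net[of u] u unfolding U_def by blast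
    have "(\<Sum>i\<in>I. (u i + v i)\<^sup>2) \<le> (\<Sum>i\<in>I. 2 * (u i)\<^sup>2 + 2 * (v i)\<^sup>2)"
    proof (rule sum_mono)
      show "(u i + v i)\<^sup>2 \<le> 2 * (u i)\<^sup>2 + 2 * (v i)\<^sup>2" for i
        using zero_le_power2[of "u i - v i"] by (simp add: power2_eq_square algebra_simps)
    qed
    also have "\<dots> \<le> 4"
      using u V[OF v(1)] by (simp add: U_def sum.distrib flip: sum_distrib_left)
    finally have 4: "(\<Sum>i\<in>I. (u i + v i)\<^sup>2) \<le> 4" .
    have "bilin I A v u = bilin I A u v"
      by (rule bilin_sym) (rule sym)
    then have "quad I A u - quad I A v = bilin I A (\<lambda>i. u i - v i) (\<lambda>i. u i + v i)"
      by (simp add: bilin_add_right bilin_diff_left)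
    \<comment> \<open>The factor 8 balances the two arguments: 8 (u - v) and u + v both have squared
      norm at most 4.\<close>
    also have "\<dots> = bilin I A (\<lambda>i. 8 * (u i - v i)) (\<lambda>i. u i + v i) / 8"
      by (simp only: bilin_scale_left)
    also have "\<bar>\<dots>\<bar> \<le> N / 2 * ((\<Sum>i\<in>I. (8 * (u i - v i))\<^sup>2) + (\<Sum>i\<in>I. (u i + v i)\<^sup>2)) / 8"
      using bilin_le_quad_bound[of I A N "\<lambda>i. 8 * (u i - v i)" "\<lambda>i. u i + v i"] sym N by simp
    also have "\<dots> \<le> N / 2 * (4 + 4) / 8"
    proof (intro divide_right_mono mult_left_mono add_mono 4)
      show "(\<Sum>i\<in>I. (8 * (u i - v i))\<^sup>2) \<le> 4"
        unfolding power_mult_distrib sum_distrib_left[symmetric] using v(2) by simp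
    qed (use N0 in auto)
    also have "\<dots> = N / 2" by simp
    finally show ?thesis using m[OF v(1)] abs_triangle_ineq4[of "quad I A v" "quad I A v - quad I A u"]
      by (simp add: abs_minus_commute)
  qed
  then have "N \<le> m + N / 2"
    unfolding N_def using \<open>(\<lambda>_. 0) \<in> U\<close> by (intro cSUP_least) auto
  then have "N \<le> 2 * m" by simp
  then have "N * (\<Sum>i\<in>I. (u i)\<^sup>2) \<le> 2 * m * (\<Sum>i\<in>I. (u i)\<^sup>2)"
    by (intro mult_right_mono) (auto simp: sum_nonneg)
  then show ?thesis using N[of u] by linarith
qed

text \<open>Schur test for symmetric matrices: 2 |u_i u_j| <= u_i^2 + u_j^2, and by symmetry both
  halves are weighted by the same row sums.\<close>

lemma quad_le_row_sums:
  assumes sym: "\<And>i j. i \<in> I \<Longrightarrow> j \<in> I \<Longrightarrow> A i j = A j i"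
    and row: "\<And>i. i \<in> I \<Longrightarrow> (\<Sum>j\<in>I. \<bar>A i j\<bar>) \<le> R"
  shows "\<bar>quad I A u\<bar> \<le> R * (\<Sum>i\<in>I. (u i)\<^sup>2)"
proof -
  have "\<bar>quad I A u\<bar> \<le> (\<Sum>i\<in>I. \<Sum>j\<in>I. \<bar>A i j * u i * u j\<bar>)"
    unfolding bilin_def by (intro order.trans[OF sum_abs] sum_mono sum_abs)
  also have "\<dots> \<le> (\<Sum>i\<in>I. \<Sum>j\<in>I. \<bar>A i j\<bar> * (u i)\<^sup>2 / 2 + \<bar>A i j\<bar> * (u j)\<^sup>2 / 2)"
  proof (intro sum_mono)
    fix i j
    have "\<bar>u i * u j\<bar> \<le> (u i)\<^sup>2 / 2 + (u j)\<^sup>2 / 2"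
      using zero_le_power2[of "\<bar>u i\<bar> - \<bar>u j\<bar>"] by (simp add: power2_diff abs_mult)
    from mult_left_mono[OF this, of "\<bar>A i j\<bar>"]
    show "\<bar>A i j * u i * u j\<bar> \<le> \<bar>A i j\<bar> * (u i)\<^sup>2 / 2 + \<bar>A i j\<bar> * (u j)\<^sup>2 / 2"
      by (simp add: abs_mult algebra_simps)
  qed
  also have "\<dots> = (\<Sum>i\<in>I. \<Sum>j\<in>I. \<bar>A i j\<bar> * (u i)\<^sup>2 / 2) + (\<Sum>i\<in>I. \<Sum>j\<in>I. \<bar>A i j\<bar> * (u j)\<^sup>2 / 2)"
    by (simp add: sum.distrib)
  also have "(\<Sum>i\<in>I. \<Sum>j\<in>I. \<bar>A i j\<bar> * (u j)\<^sup>2 / 2) = (\<Sum>i\<in>I. \<Sum>j\<in>I. \<bar>A i j\<bar> * (u i)\<^sup>2 / 2)"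
    by (subst sum.swap) (intro sum.cong refl, simp add: sym)
  also have "(\<Sum>i\<in>I. \<Sum>j\<in>I. \<bar>A i j\<bar> * (u i)\<^sup>2 / 2) + (\<Sum>i\<in>I. \<Sum>j\<in>I. \<bar>A i j\<bar> * (u i)\<^sup>2 / 2)
      = (\<Sum>i\<in>I. (\<Sum>j\<in>I. \<bar>A i j\<bar>) * (u i)\<^sup>2)"
    by (simp add: sum_distrib_right flip: sum.distrib)
  also have "\<dots> \<le> (\<Sum>i\<in>I. R * (u i)\<^sup>2)"
    by (intro sum_mono mult_right_mono row) auto
  finally show ?thesis by (simp add: sum_distrib_left)
qed

section \<open>Operator norm of a symmetric matrix through its quadratic form\<close>

lemma l2_norm_eq: "dim_vec v = p \<Longrightarrow> l2_norm v = sqrt (\<Sum>i<p. (v $ i)\<^sup>2)"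
  by (simp add: l2_norm_def scalar_prod_def power2_eq_square lessThan_atLeast0)

text \<open>The length of w = B v equals b(w / |w|, v), a form at two unit vectors, to which
  polarization applies.\<close>

lemma l2_norm_mult_le_quad_bound:
  fixes B :: "real mat"
  assumes B: "B \<in> carrier_mat p p" and "0 \<le> c"
    and sym: "\<And>i j. i < p \<Longrightarrow> j < p \<Longrightarrow> B $$ (i, j) = B $$ (j, i)"
    and bound: "\<And>u. \<bar>quad {..<p} (\<lambda>i j. B $$ (i, j)) u\<bar> \<le> c * (\<Sum>i<p. (u i)\<^sup>2)"
    and v: "v \<in> carrier_vec p" and "l2_norm v = 1"
  shows "l2_norm (B *\<^sub>v v) \<le> c"
proof -
  from v have v: "dim_vec v = p" by simp
  with \<open>l2_norm v = 1\<close> have v1: "(\<Sum>i<p. (v $ i)\<^sup>2) = 1" by (simp add: l2_norm_eq)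
  define w where "w i = (B *\<^sub>v v) $ i" for i
  define r where "r = sqrt (\<Sum>i<p. (w i)\<^sup>2)"
  have r: "l2_norm (B *\<^sub>v v) = r"
    using B by (subst l2_norm_eq[of _ p]) (auto simp: r_def w_def)
  have r2: "r\<^sup>2 = (\<Sum>i<p. (w i)\<^sup>2)" by (simp add: r_def sum_nonneg)
  have w: "w i = (\<Sum>j<p. B $$ (i, j) * v $ j)" if "i < p" for i
    using that B v by (simp add: w_def scalar_prod_def lessThan_atLeast0)
  have wv: "bilin {..<p} (\<lambda>i j. B $$ (i, j)) w (\<lambda>j. v $ j) = r\<^sup>2"
    unfolding r2 bilin_def
    by (intro sum.cong refl) (simp add: w power2_eq_square sum_distrib_left mult_ac)
  show "l2_norm (B *\<^sub>v v) \<le> c"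
  proof (cases "r = 0")
    case False
    then have r0: "0 < r" by (simp add: r_def less_le sum_nonneg)
    have "(\<Sum>i<p. (1 / r * w i)\<^sup>2) = 1"
      using r0 unfolding power_mult_distrib sum_distrib_left[symmetric] r2[symmetric]
      by (simp add: power_divide)
    then have "\<bar>bilin {..<p} (\<lambda>i j. B $$ (i, j)) (\<lambda>i. 1 / r * w i) (\<lambda>j. v $ j)\<bar> \<le> c / 2 * (1 + 1)"
      using bilin_le_quad_bound[of "{..<p}" "\<lambda>i j. B $$ (i, j)" c "\<lambda>i. 1 / r * w i" "\<lambda>j. v $ j"]
        sym bound v1 by simp
    also have "bilin {..<p} (\<lambda>i j. B $$ (i, j)) (\<lambda>i. 1 / r * w i) (\<lambda>j. v $ j) = r"
      unfolding bilin_scale_left wv using r0 by (simp add: power2_eq_square)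
    finally show ?thesis using r by simp
  qed (use r \<open>0 \<le> c\<close> in simp)
qed

text \<open>A supremum of reals is meaningful only over a nonempty bounded set, which
  \<open>0 < p\<close> and the bound provide. The absolute value is bounded because the loss squares
  the norm.\<close>

lemma abs_op_norm_le_quad_bound:
  fixes B :: "real mat"
  assumes B: "B \<in> carrier_mat p p" and "0 < p" and c: "0 \<le> c"
    and sym: "\<And>i j. i < p \<Longrightarrow> j < p \<Longrightarrow> B $$ (i, j) = B $$ (j, i)"
    and bound: "\<And>u. \<bar>quad {..<p} (\<lambda>i j. B $$ (i, j)) u\<bar> \<le> c * (\<Sum>i<p. (u i)\<^sup>2)"
  shows "\<bar>op_norm B\<bar> \<le> c"
proof -
  let ?S = "{v \<in> carrier_vec (dim_col B). l2_norm v = 1}"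
  have le: "l2_norm (B *\<^sub>v v) \<le> c" if "v \<in> ?S" for v
    using l2_norm_mult_le_quad_bound[OF B c sym bound, of v] that B by auto
  have e: "unit_vec p 0 \<in> ?S"
    using \<open>0 < p\<close> B by (simp add: l2_norm_def)
  have "op_norm B \<le> c"
    unfolding op_norm_def using e le by (intro cSUP_least) auto
  moreover have "0 \<le> l2_norm (B *\<^sub>v unit_vec p 0)"
    by (simp add: l2_norm_eq[OF refl] sum_nonneg)
  then have "0 \<le> op_norm B"
    unfolding op_norm_def using e le by (intro cSUP_upper2[OF _ e] bdd_aboveI2) auto
  ultimately show ?thesis by simp
qed

(* Window l of length m is {l - m, ..., l - 1}; with this indexing l ranges over naturals only, and truncated windows at both ends are included. *)
definition in_window :: "nat \<Rightarrow> nat \<Rightarrow> nat \<Rightarrow> real" where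
  "in_window m l i = of_bool (i < l \<and> l \<le> i + m)"

text \<open>Window l contains both i and j iff max i j < l <= min i j + m, which leaves m - |i - j|
  positions if that is positive. All of them lie below p + k, a range common to all lengths m <=
  k.\<close>

lemma sum_in_window2:
  assumes "i < p" "j < p" "m \<le> k"
  shows "(\<Sum>l\<le>p + k. in_window m l i * in_window m l j) = max 0 (real m - \<bar>real i - real j\<bar>)"
proof -
  have "(\<Sum>l\<le>p + k. in_window m l i * in_window m l j)
      = (\<Sum>l\<le>p + k. if l \<in> {max i j<..min i j + m} then 1 else 0)"
    by (intro sum.cong) (auto simp: in_window_def)
  also have "\<dots> = real (card ({..p + k} \<inter> {max i j<..min i j + m}))"
    by (subst sum.inter_restrict[symmetric]) auto
  also have "{..p + k} \<inter> {max i j<..min i j + m} = {max i j<..min i j + m}"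
    using assms by auto
  also have "real (card {max i j<..min i j + m}) = max 0 (real m - \<bar>real i - real j\<bar>)"
    by (auto simp: max_def min_def of_nat_diff)
  finally show ?thesis .
qed

lemma sum_in_window:
  assumes "i < p" "m \<le> k"
  shows "(\<Sum>l\<le>p + k. in_window m l i) = real m"
proof -
  have "(\<Sum>l\<le>p + k. in_window m l i) = (\<Sum>l\<le>p + k. in_window m l i * in_window m l i)"
    by (intro sum.cong) (auto simp: in_window_def)
  then show ?thesis using sum_in_window2[of i p i m k] assms by simp
qed

text \<open>The factor 3 is (k + h) / h: each index lies in exactly m windows of length m, truncated
  ones included, so the forms summed over windows are at most m N |u|^2, for m = k and for m = h.
  The hypothesis on windows of length k covers both lengths.\<close>

lemma taper_quad_bound:
  fixes A :: "nat \<Rightarrow> nat \<Rightarrow> real"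
  assumes h: "0 < h" and k: "k = 2 * h" and "0 \<le> N"
    and bound: "\<And>l u. l \<le> p + k \<Longrightarrow>
      \<bar>quad {i. i < p \<and> i < l \<and> l \<le> i + k} A u\<bar> \<le> N * (\<Sum>i | i < p \<and> i < l \<and> l \<le> i + k. (u i)\<^sup>2)"
  shows "\<bar>quad {..<p} (\<lambda>i j. taper_weight k i j * A i j) u\<bar> \<le> 3 * N * (\<Sum>i<p. (u i)\<^sup>2)"
proof -
  define Q where "Q m = (\<Sum>l\<le>p + k. quad {..<p} A (\<lambda>i. in_window m l i * u i))" for m
  have Q: "Q m = (\<Sum>i<p. \<Sum>j<p. max 0 (real m - \<bar>real i - real j\<bar>) * (A i j * u i * u j))"
    if m: "m \<le> k" for m
  proof -
    have "Q m = (\<Sum>i<p. \<Sum>j<p. \<Sum>l\<le>p + k. A i j * (in_window m l i * u i) * (in_window m l j * u j))"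
      unfolding Q_def bilin_def by (subst sum.swap) (rule sum.cong[OF refl], rule sum.swap)
    also have "\<dots> = (\<Sum>i<p. \<Sum>j<p. (\<Sum>l\<le>p + k. in_window m l i * in_window m l j) * (A i j * u i * u j))"
      unfolding sum_distrib_right by (intro sum.cong refl) (simp add: mult_ac)
    also have "\<dots> = (\<Sum>i<p. \<Sum>j<p. max 0 (real m - \<bar>real i - real j\<bar>) * (A i j * u i * u j))"
      using m by (intro sum.cong refl) (simp add: sum_in_window2)
    finally show ?thesis .
  qed
  have Q_le: "\<bar>Q m\<bar> \<le> real m * N * (\<Sum>i<p. (u i)\<^sup>2)" if m: "m \<le> k" for m
  proof -
    have "\<bar>quad {..<p} A (\<lambda>i. in_window m l i * u i)\<bar> \<le> N * (\<Sum>i<p. in_window m l i * (u i)\<^sup>2)"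
      if l: "l \<le> p + k" for l
    proof -
      let ?W = "{i. i < p \<and> i < l \<and> l \<le> i + k}"
      have W: "?W \<subseteq> {..<p}" "finite ?W" by auto
      \<comment> \<open>Windows l of lengths m and k share the right end, so the shorter one lies
        inside \<open>?W\<close>.\<close>
      have z: "in_window m l i = 0" if "i \<in> {..<p} - ?W" for i
        using that m by (auto simp: in_window_def)
      have eq: "quad {..<p} A (\<lambda>i. in_window m l i * u i) = quad ?W A (\<lambda>i. in_window m l i * u i)"
        unfolding bilin_def using W z
        by (intro sum.mono_neutral_cong_right ballI sum.neutral) (auto intro!: sum.mono_neutral_right)
      have "\<bar>quad {..<p} A (\<lambda>i. in_window m l i * u i)\<bar> \<le> N * (\<Sum>i\<in>?W. (in_window m l i * u i)\<^sup>2)"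
        unfolding eq by (rule bound[OF l])
      also have "\<dots> \<le> N * (\<Sum>i<p. (in_window m l i * u i)\<^sup>2)"
        by (rule mult_left_mono[OF sum_mono2[OF finite_lessThan W(1)] \<open>0 \<le> N\<close>]) (rule zero_le_power2)
      also have "\<dots> = N * (\<Sum>i<p. in_window m l i * (u i)\<^sup>2)"
      proof -
        have "(in_window m l i)\<^sup>2 = in_window m l i" for i
          by (simp add: in_window_def power2_eq_square)
        then show ?thesis by (simp add: power_mult_distrib)
      qed
      finally show ?thesis .
    qed
    then have "\<bar>Q m\<bar> \<le> (\<Sum>l\<le>p + k. N * (\<Sum>i<p. in_window m l i * (u i)\<^sup>2))"
      unfolding Q_def by (intro order.trans[OF sum_abs] sum_mono) auto
    also have "\<dots> = N * (\<Sum>i<p. (\<Sum>l\<le>p + k. in_window m l i) * (u i)\<^sup>2)"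
      unfolding sum_distrib_left[symmetric] sum_distrib_right by (subst sum.swap) (rule refl)
    also have "\<dots> = real m * N * (\<Sum>i<p. (u i)\<^sup>2)"
      using m by (simp add: sum_in_window mult_ac flip: sum_distrib_left)
    finally show ?thesis .
  qed
  have "quad {..<p} (\<lambda>i j. taper_weight k i j * A i j) u
      = (\<Sum>i<p. \<Sum>j<p. (max 0 (real k - \<bar>real i - real j\<bar>) * (A i j * u i * u j)
          - max 0 (real h - \<bar>real i - real j\<bar>) * (A i j * u i * u j)) / real h)"
    unfolding bilin_def using h k
    by (intro sum.cong refl) (simp add: taper_weight_def Let_def field_simps)
  also have "\<dots> = (Q k - Q h) / real h"
    using k by (simp add: Q sum_subtractf flip: sum_divide_distrib)
  finally have "\<bar>quad {..<p} (\<lambda>i j. taper_weight k i j * A i j) u\<bar> \<le> (\<bar>Q k\<bar> + \<bar>Q h\<bar>) / real h"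
    using h by (simp add: divide_right_mono abs_triangle_ineq4)
  also have "\<dots> \<le> (real k * N * (\<Sum>i<p. (u i)\<^sup>2) + real h * N * (\<Sum>i<p. (u i)\<^sup>2)) / real h"
    using k by (intro divide_right_mono add_mono Q_le) auto
  also have "\<dots> = 3 * N * (\<Sum>i<p. (u i)\<^sup>2)"
    using h k by (simp add: field_simps)
  finally show ?thesis .
qed

text \<open>V is fixed before A: the net must not depend on the sample, since A will be the random
  error matrix and a union bound runs over V. The first factor of the cardinality counts the window
  positions; 6 is 3 from tapering times 2 from the net.\<close>

lemma exists_taper_net:
  assumes "even k" "1 \<le> k"
  shows "\<exists>V :: (nat \<Rightarrow> real) set. finite V \<and> card V \<le> (p + k + 1) * 196608 ^ k
    \<and> (\<forall>v\<in>V. (\<Sum>i<p. (v i)\<^sup>2) \<le> 1)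
    \<and> (\<forall>A m u. (\<forall>i<p. \<forall>j<p. A i j = A j i) \<longrightarrow> 0 \<le> m \<longrightarrow> (\<forall>v\<in>V. \<bar>quad {..<p} A v\<bar> \<le> m) \<longrightarrow>
        \<bar>quad {..<p} (\<lambda>i j. taper_weight k i j * A i j) u\<bar> \<le> 6 * m * (\<Sum>i<p. (u i)\<^sup>2))"
proof -
  define W where "W l = {i. i < p \<and> i < l \<and> l \<le> i + k}" for l
  have W: "finite (W l)" "W l \<subseteq> {..<p}" "card (W l) \<le> k" for l
  proof -
    show "finite (W l)" "W l \<subseteq> {..<p}" by (auto simp: W_def)
    have "card (W l) \<le> card {l - k..<l}" by (intro card_mono) (auto simp: W_def)
    then show "card (W l) \<le> k" by simp
  qed
  have "\<exists>V. \<forall>l. finite (V l) \<and> card (V l) \<le> 196608 ^ k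
    \<and> (\<forall>v\<in>V l. (\<forall>i. i \<notin> W l \<longrightarrow> v i = 0) \<and> (\<Sum>i\<in>W l. (v i)\<^sup>2) \<le> 1)
    \<and> (\<forall>u :: nat \<Rightarrow> real. (\<Sum>i\<in>W l. (u i)\<^sup>2) \<le> 1 \<longrightarrow> (\<exists>v\<in>V l. (\<Sum>i\<in>W l. (u i - v i)\<^sup>2) \<le> 1/16))"
    by (rule choice) (intro allI exists_finite_net[OF W(1,3) assms(2)])
  then obtain V where V0: "\<forall>l. finite (V l) \<and> card (V l) \<le> 196608 ^ k
    \<and> (\<forall>v\<in>V l. (\<forall>i. i \<notin> W l \<longrightarrow> v i = 0) \<and> (\<Sum>i\<in>W l. (v i)\<^sup>2) \<le> 1)
    \<and> (\<forall>u :: nat \<Rightarrow> real. (\<Sum>i\<in>W l. (u i)\<^sup>2) \<le> 1 \<longrightarrow> (\<exists>v\<in>V l. (\<Sum>i\<in>W l. (u i - v i)\<^sup>2) \<le> 1/16))"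
    by (rule exE)
  have V: "finite (V l)" "card (V l) \<le> 196608 ^ k"
      "\<And>v i. v \<in> V l \<Longrightarrow> i \<notin> W l \<Longrightarrow> v i = 0" "\<And>v. v \<in> V l \<Longrightarrow> (\<Sum>i\<in>W l. (v i)\<^sup>2) \<le> 1"
      "\<And>u :: nat \<Rightarrow> real. (\<Sum>i\<in>W l. (u i)\<^sup>2) \<le> 1 \<Longrightarrow> \<exists>v\<in>V l. (\<Sum>i\<in>W l. (u i - v i)\<^sup>2) \<le> 1/16" for l
    using V0[THEN spec, of l] by blast+
  let ?V = "\<Union>l\<le>p + k. V l"
  obtain h where h: "k = 2 * h" using assms(1) by (elim evenE)
  show ?thesis
  proof (intro exI[of _ ?V] conjI ballI allI impI)
    show "finite ?V" using V by auto
    have "card ?V \<le> (\<Sum>l\<le>p + k. card (V l))" by (rule card_UN_le) simp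
    also have "\<dots> \<le> (\<Sum>l\<le>p + k. 196608 ^ k)" by (intro sum_mono V)
    finally show "card ?V \<le> (p + k + 1) * 196608 ^ k" by simp
    have supp: "(\<Sum>i<p. (v i)\<^sup>2) = (\<Sum>i\<in>W l. (v i)\<^sup>2)" "quad {..<p} A v = quad (W l) A v"
      if "v \<in> V l" for v l A
    proof -
      show "(\<Sum>i<p. (v i)\<^sup>2) = (\<Sum>i\<in>W l. (v i)\<^sup>2)"
        using W V(3)[OF that] by (intro sum.mono_neutral_right) auto
      show "quad {..<p} A v = quad (W l) A v"
        unfolding bilin_def using W V(3)[OF that]
        by (intro sum.mono_neutral_cong_right ballI sum.neutral) (auto intro!: sum.mono_neutral_right)
    qed
    show "(\<Sum>i<p. (v i)\<^sup>2) \<le> 1" if "v \<in> ?V" for v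
      using that V(4) supp by auto
    fix A :: "nat \<Rightarrow> nat \<Rightarrow> real" and m :: real and u :: "nat \<Rightarrow> real"
    assume sym: "\<forall>i<p. \<forall>j<p. A i j = A j i" and "0 \<le> m"
      and m: "\<forall>v\<in>?V. \<bar>quad {..<p} A v\<bar> \<le> m"
    have "\<bar>quad (W l) A w\<bar> \<le> 2 * m * (\<Sum>i\<in>W l. (w i)\<^sup>2)" if "l \<le> p + k" for l w
    proof (rule quad_le_twice_net_bound[where V = "V l"])
      show "A i j = A j i" if "i \<in> W l" "j \<in> W l" for i j
        using sym that by (simp add: W_def)
      show "\<bar>quad (W l) A v\<bar> \<le> m" if "v \<in> V l" for v
        using m that \<open>l \<le> p + k\<close> supp(2)[OF that] by (metis UN_I atMost_iff)
    qed (use W V in auto)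
    then have "\<bar>quad {..<p} (\<lambda>i j. taper_weight k i j * A i j) u\<bar> \<le> 3 * (2 * m) * (\<Sum>i<p. (u i)\<^sup>2)"
      using assms h \<open>0 \<le> m\<close> by (intro taper_quad_bound[of h]) (auto simp: W_def)
    then show "\<bar>quad {..<p} (\<lambda>i j. taper_weight k i j * A i j) u\<bar> \<le> 6 * m * (\<Sum>i<p. (u i)\<^sup>2)"
      by simp
  qed
qed

section \<open>Sub-Gaussian laws\<close>

locale sub_gaussian_law =
  fixes p :: nat and P :: "(nat \<Rightarrow> real) measure" and \<rho> :: real
  assumes law: "P \<in> L2_laws p" and sub_gaussian: "sub_gaussian p \<rho> P" and \<rho>_pos: "0 < \<rho>"
begin

sublocale prob_space P
  using law by (simp add: L2_laws_def)

abbreviation cov :: "nat \<Rightarrow> nat \<Rightarrow> real" where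
  "cov i j \<equiv> cov_mat p P $$ (i, j)"

definition centered :: "nat \<Rightarrow> (nat \<Rightarrow> real) \<Rightarrow> real" where
  "centered i x = x i - (\<integral>x. x i \<partial>P)"

definition proj :: "(nat \<Rightarrow> real) \<Rightarrow> (nat \<Rightarrow> real) \<Rightarrow> real" where
  "proj v x = (\<Sum>i<p. v i * centered i x)"

lemma coordinate_measurable:
  assumes "i < p"
  shows "(\<lambda>x. x i) \<in> borel_measurable P"
proof -
  have "sets P = sets (PiM {..<p} (\<lambda>_. borel))"
    using law by (simp add: L2_laws_def Rp_def)
  then have "measurable P borel = measurable (PiM {..<p} (\<lambda>_. borel :: real measure)) borel"
    by (intro measurable_cong_sets) auto
  moreover have "i \<in> {..<p}" using assms by simp
  ultimately show ?thesis
    using measurable_component_singleton[of i "{..<p}" "\<lambda>_. borel :: real measure"] by blast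
qed

lemma integrable_coordinate_sq: "i < p \<Longrightarrow> integrable P (\<lambda>x. (x i)\<^sup>2)"
  using law by (simp add: L2_laws_def)

lemma integrable_coordinate: "i < p \<Longrightarrow> integrable P (\<lambda>x. x i)"
  by (rule square_integrable_imp_integrable[OF coordinate_measurable integrable_coordinate_sq])

lemma integrable_centered: "i < p \<Longrightarrow> integrable P (centered i)"
  unfolding centered_def[abs_def] using integrable_coordinate by simp

lemma integrable_coordinate_mult:
  assumes "i < p" "j < p"
  shows "integrable P (\<lambda>x. x i * x j)"
proof (rule Bochner_Integration.integrable_bound)
  show "integrable P (\<lambda>x. (x i)\<^sup>2 + (x j)\<^sup>2)"
    using assms integrable_coordinate_sq by simp
  show "(\<lambda>x. x i * x j) \<in> borel_measurable P"
    using coordinate_measurable assms by measurable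
  have "\<bar>a * b\<bar> \<le> a\<^sup>2 + b\<^sup>2" for a b :: real
  proof -
    have "0 \<le> (\<bar>a\<bar> - \<bar>b\<bar>)\<^sup>2" by simp
    then have "2 * \<bar>a * b\<bar> \<le> a\<^sup>2 + b\<^sup>2" by (simp add: power2_diff abs_mult)
    then show ?thesis by linarith
  qed
  then show "AE x in P. norm (x i * x j) \<le> norm ((x i)\<^sup>2 + (x j)\<^sup>2)"
    by simp
qed

lemma integrable_centered_mult:
  assumes "i < p" "j < p"
  shows "integrable P (\<lambda>x. centered i x * centered j x)"
proof -
  have "integrable P (\<lambda>x. x i * x j - (\<integral>x. x j \<partial>P) * x i - (\<integral>x. x i \<partial>P) * x j
      + (\<integral>x. x i \<partial>P) * (\<integral>x. x j \<partial>P))"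
    using assms integrable_coordinate integrable_coordinate_mult by simp
  then show ?thesis by (simp add: centered_def algebra_simps)
qed

lemma cov_eq: "i < p \<Longrightarrow> j < p \<Longrightarrow> cov i j = (\<integral>x. centered i x * centered j x \<partial>P)"
  by (simp add: cov_mat_def mean_vec_def centered_def)

lemma cov_sym: "i < p \<Longrightarrow> j < p \<Longrightarrow> cov i j = cov j i"
  by (simp add: cov_eq mult.commute)

section \<open>Projections: moments, tails and exponential moments\<close>

lemma proj_measurable: "proj v \<in> borel_measurable P"
  unfolding proj_def[abs_def]
  using borel_measurable_integrable[OF integrable_centered] by (intro borel_measurable_sum) auto

lemma integrable_proj: "integrable P (proj v)"
  unfolding proj_def[abs_def] using integrable_centered by (intro Bochner_Integration.integrable_sum) auto

lemma integral_proj: "(\<integral>x. proj v x \<partial>P) = 0"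
proof -
  have "(\<integral>x. centered i x \<partial>P) = 0" if "i < p" for i
    using integrable_coordinate[OF that] by (simp add: centered_def prob_space)
  then show ?thesis
    unfolding proj_def using integrable_centered by (subst Bochner_Integration.integral_sum) auto
qed

lemma proj_sq: "(proj v x)\<^sup>2 = (\<Sum>i<p. \<Sum>j<p. v i * v j * (centered i x * centered j x))"
  by (simp add: proj_def power2_eq_square sum_product mult_ac)

lemma integrable_proj_sq: "integrable P (\<lambda>x. (proj v x)\<^sup>2)"
  unfolding proj_sq using integrable_centered_mult
  by (intro Bochner_Integration.integrable_sum) auto

lemma integral_proj_sq: "(\<integral>x. (proj v x)\<^sup>2 \<partial>P) = quad {..<p} cov v"
proof -
  have "(\<integral>x. (proj v x)\<^sup>2 \<partial>P)
      = (\<Sum>i<p. \<integral>x. (\<Sum>j<p. v i * v j * (centered i x * centered j x)) \<partial>P)"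
    unfolding proj_sq using integrable_centered_mult
    by (intro Bochner_Integration.integral_sum Bochner_Integration.integrable_sum) auto
  also have "\<dots> = (\<Sum>i<p. \<Sum>j<p. \<integral>x. v i * v j * (centered i x * centered j x) \<partial>P)"
    using integrable_centered_mult
    by (intro sum.cong refl Bochner_Integration.integral_sum) auto
  also have "\<dots> = quad {..<p} cov v"
    unfolding bilin_def by (intro sum.cong refl) (simp add: cov_eq)
  finally show ?thesis .
qed

text \<open>The sub-Gaussian condition concerns unit vectors, whereas net vectors may be shorter;
  normalizing by r <= 1 raises the threshold to t / r >= t, which only lowers the bound. The zero
  vector is treated apart.\<close>

lemma proj_tail:
  assumes v: "(\<Sum>i<p. (v i)\<^sup>2) \<le> 1" and t: "0 < t"
  shows "measure P {x \<in> space P. t < \<bar>proj v x\<bar>} \<le> exp (- (t\<^sup>2 * \<rho> / 2))"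
proof (cases "(\<Sum>i<p. (v i)\<^sup>2) = 0")
  case True
  then have "\<forall>i<p. v i = 0" by (simp add: sum_nonneg_eq_0_iff)
  then have "proj v x = 0" for x by (simp add: proj_def)
  then show ?thesis using t by simp
next
  case False
  define r where "r = sqrt (\<Sum>i<p. (v i)\<^sup>2)"
  have r: "0 < r" "r \<le> 1" and r2: "(\<Sum>i<p. (v i)\<^sup>2) = r\<^sup>2"
    using False v by (auto simp: r_def less_le sum_nonneg)
  define u where "u = vec p (\<lambda>i. v i / r)"
  have "l2_norm u = 1"
    using r by (subst l2_norm_eq[of _ p]) (auto simp: u_def power_divide r2 simp flip: sum_divide_distrib)
  moreover have "u \<in> carrier_vec p" by (simp add: u_def)
  moreover have "0 < t / r" using t r by simp
  ultimately have "measure P {x \<in> space P. \<bar>u \<bullet> (vec p x - mean_vec p P)\<bar> > t / r}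
      \<le> exp (- ((t / r)\<^sup>2 * \<rho> / 2))"
    using sub_gaussian unfolding sub_gaussian_def by blast
  moreover have "u \<bullet> (vec p x - mean_vec p P) = proj v x / r" for x
    by (simp add: u_def scalar_prod_def mean_vec_def proj_def centered_def sum_divide_distrib lessThan_atLeast0)
  moreover have "{x \<in> space P. \<bar>proj v x / r\<bar> > t / r} = {x \<in> space P. t < \<bar>proj v x\<bar>}"
    using r by (auto simp: divide_less_cancel)
  ultimately have "measure P {x \<in> space P. t < \<bar>proj v x\<bar>} \<le> exp (- ((t / r)\<^sup>2 * \<rho> / 2))"
    by simp
  also have "\<dots> \<le> exp (- (t\<^sup>2 * \<rho> / 2))"
  proof -
    have "t \<le> t / r" using r t by (simp add: field_simps)
    then have "t\<^sup>2 \<le> (t / r)\<^sup>2" using t by (intro power_mono) auto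
    then show ?thesis using \<rho>_pos by (simp add: mult_right_mono)
  qed
  finally show ?thesis .
qed

lemma exp_proj_sq_moment:
  assumes v: "(\<Sum>i<p. (v i)\<^sup>2) \<le> 1"
  shows "(\<integral>\<^sup>+ x. ennreal (exp (\<rho> / 4 * (proj v x)\<^sup>2)) \<partial>P) \<le> 7"
proof (rule nn_integral_exp_le)
  show "prob_space P" by (rule prob_space_axioms)
  show "(\<lambda>x. \<rho> / 4 * (proj v x)\<^sup>2) \<in> borel_measurable P"
    using proj_measurable by measurable
  fix s :: real assume s: "0 < s"
  \<comment> \<open>The threshold at which rho / 4 * z^2 > s means |z| > t; then t^2 rho / 2 = 2 s,
    the rate required by \<open>nn_integral_exp_le\<close>.\<close>
  define t where "t = sqrt (4 * s / \<rho>)"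
  have t: "0 < t" "t\<^sup>2 = 4 * s / \<rho>" using s \<rho>_pos by (auto simp: t_def)
  have "s < \<rho> / 4 * z\<^sup>2 \<longleftrightarrow> t < \<bar>z\<bar>" for z
  proof -
    have "s < \<rho> / 4 * z\<^sup>2 \<longleftrightarrow> t\<^sup>2 < \<bar>z\<bar>\<^sup>2" unfolding t(2) using \<rho>_pos by (simp add: field_simps)
    also have "\<dots> \<longleftrightarrow> t < \<bar>z\<bar>" using t(1) power2_less_imp_less[of t "\<bar>z\<bar>"] power_strict_mono[of t "\<bar>z\<bar>" 2] by fastforce
    finally show ?thesis .
  qed
  then show "measure P {x \<in> space P. \<rho> / 4 * (proj v x)\<^sup>2 > s} \<le> exp (- 2 * s)"
    using proj_tail[OF v t(1)] t(2) \<rho>_pos by simp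
qed

text \<open>The scale sqrt (rho / 4) makes the square equal to the exponent of
  \<open>exp_proj_sq_moment\<close>; the mean is 0, so the linear term integrates to 0.\<close>

lemma proj_mgf:
  assumes v: "(\<Sum>i<p. (v i)\<^sup>2) \<le> 1" and l: "\<bar>l\<bar> \<le> 1/2"
  shows "(\<integral>\<^sup>+ x. ennreal (exp (l * (sqrt (\<rho> / 4) * proj v x))) \<partial>P) \<le> ennreal (exp (28 * l\<^sup>2))"
proof -
  have "(\<integral>\<^sup>+ x. ennreal (exp (l * (sqrt (\<rho> / 4) * proj v x - 0))) \<partial>P) \<le> ennreal (exp (28 * l\<^sup>2))"
  proof (rule mgf_le)
    show "exp (l * (sqrt (\<rho> / 4) * proj v x))
        \<le> 1 + l * (sqrt (\<rho> / 4) * proj v x) + 4 * l\<^sup>2 * exp (\<rho> / 4 * (proj v x)\<^sup>2)" for x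
      using exp_mult_le_square[OF l, of "sqrt (\<rho> / 4) * proj v x"] \<rho>_pos by (simp add: power_mult_distrib)
    show "(\<lambda>x. \<rho> / 4 * (proj v x)\<^sup>2) \<in> borel_measurable P"
      using proj_measurable by measurable
  qed (use prob_space_axioms integrable_proj integral_proj exp_proj_sq_moment[OF v] in auto)
  then show ?thesis by simp
qed

lemma proj_sq_mgf:
  assumes v: "(\<Sum>i<p. (v i)\<^sup>2) \<le> 1" and l: "\<bar>l\<bar> \<le> 1/2"
  shows "(\<integral>\<^sup>+ x. ennreal (exp (l * (\<rho> / 4 * (proj v x)\<^sup>2 - \<rho> / 4 * quad {..<p} cov v))) \<partial>P)
    \<le> ennreal (exp (28 * l\<^sup>2))"
proof (rule mgf_le)
  show "exp (l * (\<rho> / 4 * (proj v x)\<^sup>2))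
      \<le> 1 + l * (\<rho> / 4 * (proj v x)\<^sup>2) + 4 * l\<^sup>2 * exp (\<rho> / 4 * (proj v x)\<^sup>2)" for x
    using \<rho>_pos by (intro exp_mult_le_nonneg l) auto
  show "(\<lambda>x. \<rho> / 4 * (proj v x)\<^sup>2) \<in> borel_measurable P"
    using proj_measurable by measurable
qed (use prob_space_axioms integrable_proj_sq integral_proj_sq exp_proj_sq_moment[OF v] in auto)

text \<open>The sample covariance is invariant under translation, so deviations may be measured from
  the true mean; what remains is mean of squares minus square of the mean for the numbers
  \<open>proj v (x l)\<close>. The identity is algebraic and holds for every sample.\<close>

lemma sample_cov_quad:
  assumes n: "0 < n"
  shows "quad {..<p} (\<lambda>i j. sample_cov n p x $$ (i, j)) v
    = (\<Sum>l<n. (proj v (x l))\<^sup>2) / n - ((\<Sum>l<n. proj v (x l)) / n)\<^sup>2"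
proof -
  define a where "a l = proj v (x l)" for l
  define b where "b = (\<Sum>l<n. a l) / n"
  have sb: "(\<Sum>l<n. a l) = n * b" using n by (simp add: b_def)
  have dev: "(\<Sum>i<p. v i * (x l i - sample_mean n x i)) = a l - b" for l
  proof -
    have "b = (\<Sum>i<p. v i * (sample_mean n x i - (\<integral>x. x i \<partial>P)))"
    proof -
      have "(\<Sum>l<n. a l) = (\<Sum>i<p. v i * (\<Sum>l<n. centered i (x l)))"
        unfolding a_def proj_def sum_distrib_left by (rule sum.swap)
      also have "\<dots> = (\<Sum>i<p. n * (v i * (sample_mean n x i - (\<integral>x. x i \<partial>P))))"
        using n by (intro sum.cong refl) (simp add: centered_def sum_subtractf sample_mean_def field_simps)
      finally show ?thesis using n unfolding b_def sum_distrib_left[symmetric] by simp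
    qed
    then show ?thesis
      by (simp add: a_def proj_def centered_def algebra_simps flip: sum_subtractf)
  qed
  have "quad {..<p} (\<lambda>i j. sample_cov n p x $$ (i, j)) v
      = (\<Sum>i<p. \<Sum>j<p. \<Sum>l<n. (v i * (x l i - sample_mean n x i)) * (v j * (x l j - sample_mean n x j)) / n)"
    unfolding bilin_def
    by (intro sum.cong refl) (simp add: sample_cov_def sum_divide_distrib sum_distrib_left sum_distrib_right mult_ac)
  also have "\<dots> = (\<Sum>i<p. \<Sum>l<n. \<Sum>j<p. (v i * (x l i - sample_mean n x i)) * (v j * (x l j - sample_mean n x j)) / n)"
    by (rule sum.cong[OF refl]) (rule sum.swap)
  also have "\<dots> = (\<Sum>l<n. \<Sum>i<p. \<Sum>j<p. (v i * (x l i - sample_mean n x i)) * (v j * (x l j - sample_mean n x j)) / n)"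
    by (rule sum.swap)
  also have "\<dots> = (\<Sum>l<n. (a l - b)\<^sup>2 / n)"
    unfolding dev[symmetric] power2_eq_square sum_product sum_divide_distrib ..
  also have "\<dots> = (\<Sum>l<n. (a l)\<^sup>2 - 2 * b * a l + b\<^sup>2) / n"
    by (simp add: power2_diff algebra_simps sum_divide_distrib)
  also have "(\<Sum>l<n. (a l)\<^sup>2 - 2 * b * a l + b\<^sup>2) = (\<Sum>l<n. (a l)\<^sup>2) - n * b\<^sup>2"
    by (simp add: sum.distrib sum_subtractf sb power2_eq_square flip: sum_distrib_left)
  finally show ?thesis using n by (simp add: a_def b_def diff_divide_distrib)
qed

end

section \<open>The risk of the tapering estimator\<close>

lemma bilin_mat_add: "bilin I (\<lambda>i j. A i j + B i j) u v = bilin I A u v + bilin I B u v"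
  by (simp add: bilin_def algebra_simps sum.distrib)

lemma bilin_mat_diff: "bilin I (\<lambda>i j. A i j - B i j) u v = bilin I A u v - bilin I B u v"
  by (simp add: bilin_def algebra_simps sum_subtractf)

lemma bilin_cong:
  "(\<And>i j. i \<in> I \<Longrightarrow> j \<in> I \<Longrightarrow> A i j = B i j) \<Longrightarrow> bilin I A u v = bilin I B u v"
  by (simp add: bilin_def)

lemma taper_weight_sym: "taper_weight k i j = taper_weight k j i"
  by (simp add: taper_weight_def abs_minus_commute)

lemma sample_cov_sym: "i < p \<Longrightarrow> j < p \<Longrightarrow> sample_cov n p x $$ (i, j) = sample_cov n p x $$ (j, i)"
  by (simp add: sample_cov_def mult.commute)

text \<open>The weights equal 1 up to distance h and lie in [0, 1] beyond, so the bias sees only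
  entries farther than h from the diagonal. The indicator is phrased over integers to match the row
  sums in \<open>F_class\<close>.\<close>

lemma taper_weight_minus_one_le:
  assumes "1 \<le> h"
  shows "\<bar>taper_weight (2 * h) i j - 1\<bar> \<le> of_bool (int h < \<bar>int i - int j\<bar>)"
proof -
  define d where "d = \<bar>real i - real j\<bar>"
  have d: "d = real_of_int \<bar>int i - int j\<bar>" by (simp add: d_def)
  have iff: "int h < \<bar>int i - int j\<bar> \<longleftrightarrow> real h < d"
    unfolding d by linarith
  have w: "taper_weight (2 * h) i j = (if d \<le> h then 1 else if d < 2 * h then 2 - d / h else 0)"
    using taper_weight_cases[of "2 * h" i j] assms by (simp add: d_def)
  show ?thesis
  proof (cases "real h < d \<and> d < 2 * h")
    case True
    then have "1 \<le> d / h" "d / h \<le> 2" using assms by (simp_all add: field_simps)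
    then show ?thesis using True unfolding iff w by simp
  next
    case False
    then show ?thesis unfolding iff w by auto
  qed
qed

text \<open>Here 2 (p + k + 1) <= 6 p, the factor 6 is absorbed in the k-th power, and 6 * 196608 =
  1179648 <= 2^21 <= exp 21. This is the origin of the constant 21 in L.\<close>

lemma net_card_le_exp:
  fixes k p :: nat
  assumes "1 \<le> k" "k \<le> p"
  shows "2 * ((real p + real k + 1) * 196608 ^ k) \<le> exp (21 * (real k + ln (real p)))"
proof -
  have "1 \<le> real k" "real k \<le> real p" using assms by auto
  then have "2 * (real p + real k + 1) \<le> 6 * real p" by simp
  then have "2 * (real p + real k + 1) * 196608 ^ k \<le> 6 * real p * 196608 ^ k"
    by (intro mult_right_mono) auto
  also have "\<dots> \<le> 6 ^ k * real p * 196608 ^ k"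
    using assms by (intro mult_right_mono self_le_power) auto
  also have "\<dots> = 1179648 ^ k * real p"
    by (simp flip: power_mult_distrib)
  also have "\<dots> \<le> exp 21 ^ k * exp (21 * ln (real p))"
  proof (intro mult_mono power_mono)
    have "(2::real) \<le> exp 1" using exp_ge_add_one_self[of 1] by simp
    then have "(2::real) ^ 21 \<le> exp 1 ^ 21" by (intro power_mono) auto
    then show "(1179648::real) \<le> exp 21" by (simp flip: exp_of_nat_mult)
    have "ln (real p) \<le> 21 * ln (real p)" using assms by simp
    then have "exp (ln (real p)) \<le> exp (21 * ln (real p))" by (simp only: exp_le_cancel_iff)
    then show "real p \<le> exp (21 * ln (real p))" using assms by simp
  qed auto
  also have "\<dots> = exp (21 * (real k + ln (real p)))"
    by (simp add: exp_add distrib_left exp_of_nat_mult[symmetric] mult.commute)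
  finally show ?thesis by (simp only: mult.assoc)
qed

section \<open>Stochastic error over the net, and the risk for fixed n\<close>

context sub_gaussian_law
begin

definition cov_error :: "nat \<Rightarrow> (nat \<Rightarrow> nat \<Rightarrow> real) \<Rightarrow> (nat \<Rightarrow> real) \<Rightarrow> real" where
  "cov_error n x v = quad {..<p} (\<lambda>i j. sample_cov n p x $$ (i, j) - cov i j) v"

text \<open>Scaled by a = rho / 4, the error is D1 - D2^2, with D1 the mean of the centred scaled
  squares and D2 the mean of the projections scaled by sqrt a. Both fourth powers have majorants
  with integral of order s^2, s = L / n, and s <= 1/4 reduces the s^2 stemming from D2 to order
  s.\<close>

lemma cov_error_second_moment:
  fixes L :: real
  assumes V: "finite V" "\<And>v. v \<in> V \<Longrightarrow> (\<Sum>i<p. (v i)\<^sup>2) \<le> 1"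
    and card: "2 * real (card V) \<le> exp L" and L: "1 \<le> L" "4 * L \<le> real n"
  shows "\<exists>H \<in> borel_measurable (PiM {..<n} (\<lambda>_. P)).
    (\<forall>x. \<forall>v\<in>V. ennreal ((cov_error n x v)\<^sup>2) \<le> H x) \<and>
    (\<integral>\<^sup>+ x. H x \<partial>PiM {..<n} (\<lambda>_. P)) \<le> ennreal (320000000 / \<rho>\<^sup>2 * (L / real n))"
proof -
  let ?Q = "PiM {..<n} (\<lambda>_. P)"
  interpret Q: prob_space ?Q
    by (rule prob_space_PiM) (rule prob_space_axioms)
  define a where "a = \<rho> / 4"
  define s where "s = L / real n"
  have a: "0 < a" using \<rho>_pos by (simp add: a_def)
  have n: "0 < real n" using L by linarith
  have s: "0 < s" "s \<le> 1/4" using L n by (auto simp: s_def field_simps)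
  define f where "f v x = a * (proj v x)\<^sup>2 - a * quad {..<p} cov v" for v x
  define g where "g v x = sqrt a * proj v x" for v x
  have "\<exists>G \<in> borel_measurable ?Q.
    (\<forall>x. \<forall>v\<in>V. ennreal (((\<Sum>l<n. f v (x l)) / real n) ^ 4) \<le> G x) \<and>
    (\<integral>\<^sup>+ x. G x \<partial>?Q) \<le> ennreal (6000000 * (L / real n)\<^sup>2)"
  proof (rule average_fourth_moment[OF prob_space_axioms V(1) _ _ card L])
    show "f v \<in> borel_measurable P" for v
      unfolding f_def[abs_def] using proj_measurable by measurable
  qed (use proj_sq_mgf V(2) in \<open>auto simp: f_def a_def\<close>)
  then obtain G1 where [measurable]: "G1 \<in> borel_measurable ?Q"
    and G1: "\<And>x v. v \<in> V \<Longrightarrow> ennreal (((\<Sum>l<n. f v (x l)) / real n) ^ 4) \<le> G1 x"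
    and int_G1: "(\<integral>\<^sup>+ x. G1 x \<partial>?Q) \<le> ennreal (6000000 * s\<^sup>2)"
    unfolding s_def by blast
  have "\<exists>G \<in> borel_measurable ?Q.
    (\<forall>x. \<forall>v\<in>V. ennreal (((\<Sum>l<n. g v (x l)) / real n) ^ 4) \<le> G x) \<and>
    (\<integral>\<^sup>+ x. G x \<partial>?Q) \<le> ennreal (6000000 * (L / real n)\<^sup>2)"
  proof (rule average_fourth_moment[OF prob_space_axioms V(1) _ _ card L])
    show "g v \<in> borel_measurable P" for v
      unfolding g_def[abs_def] using proj_measurable by measurable
  qed (use proj_mgf V(2) in \<open>auto simp: g_def a_def\<close>)
  then obtain G2 where [measurable]: "G2 \<in> borel_measurable ?Q"
    and G2: "\<And>x v. v \<in> V \<Longrightarrow> ennreal (((\<Sum>l<n. g v (x l)) / real n) ^ 4) \<le> G2 x"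
    and int_G2: "(\<integral>\<^sup>+ x. G2 x \<partial>?Q) \<le> ennreal (6000000 * s\<^sup>2)"
    unfolding s_def by blast
  have ennreal_expand: "ennreal (c * (A + b * X + Y)) = ennreal c * (ennreal A + ennreal b * ennreal X + ennreal Y)"
    if "0 \<le> c" "0 \<le> A" "0 \<le> b" "0 \<le> X" "0 \<le> Y" for c A b X Y :: real
    using that by (simp add: ennreal_mult ennreal_plus)
  define H where "H x = ennreal (2 / a\<^sup>2) * (ennreal (s / 2) + ennreal (1 / (2 * s)) * G1 x + G2 x)" for x
  show ?thesis
  proof (intro bexI[of _ H] conjI allI ballI)
    show "H \<in> borel_measurable ?Q" unfolding H_def by measurable
    fix x v assume v: "v \<in> V"
    define D1 where "D1 = (\<Sum>l<n. f v (x l)) / real n"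
    define D2 where "D2 = (\<Sum>l<n. g v (x l)) / real n"
    have D1: "D1 = a * ((\<Sum>l<n. (proj v (x l))\<^sup>2) / n - quad {..<p} cov v)"
      using n by (simp add: D1_def f_def sum_subtractf field_simps flip: sum_distrib_left)
    have D2: "D2\<^sup>2 = a * ((\<Sum>l<n. proj v (x l)) / n)\<^sup>2"
      using a by (simp add: D2_def g_def power_divide power_mult_distrib flip: sum_distrib_left)
    have "a * cov_error n x v = D1 - D2\<^sup>2"
      using n unfolding cov_error_def bilin_mat_diff D1 D2 by (subst sample_cov_quad) (auto simp: algebra_simps)
    then have "cov_error n x v = (D1 - D2\<^sup>2) / a" using a by (simp add: field_simps)
    then have "(cov_error n x v)\<^sup>2 = (D1 - D2\<^sup>2)\<^sup>2 / a\<^sup>2" by (simp add: power_divide)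
    also have "\<dots> \<le> (2 * (s / 2 + 1 / (2 * s) * D1 ^ 4 + D2 ^ 4)) / a\<^sup>2"
    proof (rule divide_right_mono)
      have "(D1 - D2\<^sup>2)\<^sup>2 \<le> 2 * D1\<^sup>2 + 2 * (D2\<^sup>2)\<^sup>2"
        using zero_le_power2[of "D1 + D2\<^sup>2"] by (simp add: power2_eq_square algebra_simps)
      \<comment> \<open>Arithmetic-geometric mean with weight s: both terms have order s in
        expectation, because D1^4 has order s^2.\<close>
      moreover have "D1\<^sup>2 \<le> s / 2 + 1 / (2 * s) * D1 ^ 4"
      proof -
        have "0 \<le> (s - D1\<^sup>2)\<^sup>2 / (2 * s)" using s by simp
        also have "\<dots> = s / 2 + 1 / (2 * s) * D1 ^ 4 - D1\<^sup>2"
          using s by (simp add: field_simps power2_eq_square power4_eq_xxxx)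
        finally show ?thesis by simp
      qed
      moreover have "(D2\<^sup>2)\<^sup>2 = D2 ^ 4" by (simp flip: power_mult)
      moreover have "u \<le> 2 * (X + Y)" if "u \<le> 2 * b + 2 * c" "b \<le> X" "c = Y" for u b c X Y :: real
        using that by simp
      ultimately show "(D1 - D2\<^sup>2)\<^sup>2 \<le> 2 * (s / 2 + 1 / (2 * s) * D1 ^ 4 + D2 ^ 4)"
        by blast
    qed simp
    also have "\<dots> = 2 / a\<^sup>2 * (s / 2 + 1 / (2 * s) * D1 ^ 4 + D2 ^ 4)" by simp
    finally have "ennreal ((cov_error n x v)\<^sup>2) \<le> ennreal (2 / a\<^sup>2 * (s / 2 + 1 / (2 * s) * D1 ^ 4 + D2 ^ 4))"
      by (rule ennreal_leI)
    also have "\<dots> = ennreal (2 / a\<^sup>2) * (ennreal (s / 2) + ennreal (1 / (2 * s)) * ennreal (D1 ^ 4) + ennreal (D2 ^ 4))"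
      using s by (intro ennreal_expand) auto
    also have "\<dots> \<le> H x"
      unfolding H_def using G1[OF v, of x] G2[OF v, of x]
      by (intro mult_left_mono add_mono) (auto simp: D1_def D2_def)
    finally show "ennreal ((cov_error n x v)\<^sup>2) \<le> H x" .
  next
    have "(\<integral>\<^sup>+ x. H x \<partial>?Q)
        = ennreal (2 / a\<^sup>2) * (ennreal (s / 2) + ennreal (1 / (2 * s)) * (\<integral>\<^sup>+ x. G1 x \<partial>?Q) + (\<integral>\<^sup>+ x. G2 x \<partial>?Q))"
      unfolding H_def by (simp add: nn_integral_cmult nn_integral_add Q.emeasure_space_1)
    also have "\<dots> \<le> ennreal (2 / a\<^sup>2) * (ennreal (s / 2) + ennreal (1 / (2 * s)) * ennreal (6000000 * s\<^sup>2)
        + ennreal (6000000 * s\<^sup>2))"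
      by (intro mult_left_mono add_mono int_G1 int_G2) auto
    also have "\<dots> = ennreal (2 / a\<^sup>2 * (s / 2 + 1 / (2 * s) * (6000000 * s\<^sup>2) + 6000000 * s\<^sup>2))"
      using s by (intro ennreal_expand[symmetric]) auto
    \<comment> \<open>The sum is at most s / 2 + 3000000 s + 1500000 s, rounded up
      generously.\<close>
    also have "\<dots> \<le> ennreal (2 / a\<^sup>2 * (10000000 * s))"
    proof (intro ennreal_leI mult_left_mono)
      have "s * s \<le> 1/4 * s" using s by (intro mult_right_mono) auto
      moreover have "s / 2 + 1 / (2 * s) * (6000000 * s\<^sup>2) + 6000000 * s\<^sup>2
          = s / 2 + 3000000 * s + 6000000 * (s * s)"
        using s by (simp add: power2_eq_square)
      ultimately show "s / 2 + 1 / (2 * s) * (6000000 * s\<^sup>2) + 6000000 * s\<^sup>2 \<le> 10000000 * s"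
        using s by linarith
    qed simp
    also have "2 / a\<^sup>2 * (10000000 * s) = 320000000 / \<rho>\<^sup>2 * (L / real n)"
      by (simp add: a_def s_def power_divide)
    finally show "(\<integral>\<^sup>+ x. H x \<partial>?Q) \<le> ennreal (320000000 / \<rho>\<^sup>2 * (L / real n))" .
  qed
qed

text \<open>The error matrix is w (S - cov) + (w - 1) cov entrywise: the first summand is tapered
  noise, controlled by \<open>net\<close>; the second is deterministic and yields to the Schur test.
  The constant 72 = 2 * 6^2 comes from (6 m + R)^2 <= 2 (6 m)^2 + 2 R^2.\<close>

lemma loss_le:
  fixes m R :: real
  assumes h: "1 \<le> h" "2 * h \<le> p" and m: "0 \<le> m" and R: "0 \<le> R"
    and net: "\<And>u. \<bar>quad {..<p} (\<lambda>i j. taper_weight (2 * h) i j * (sample_cov n p x $$ (i, j) - cov i j)) u\<bar>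
      \<le> 6 * m * (\<Sum>i<p. (u i)\<^sup>2)"
    and bias: "\<And>j. j < p \<Longrightarrow> (\<Sum>i | i < p \<and> \<bar>int i - int j\<bar> > int h. \<bar>cov i j\<bar>) \<le> R"
  shows "(op_norm (tapering_estimator n p (2 * h) x - cov_mat p P))\<^sup>2 \<le> 72 * m\<^sup>2 + 2 * R\<^sup>2"
proof -
  let ?w = "taper_weight (2 * h)"
  let ?S = "\<lambda>i j. sample_cov n p x $$ (i, j)"
  define B where "B = tapering_estimator n p (2 * h) x - cov_mat p P"
  have B: "B \<in> carrier_mat p p"
    unfolding B_def cov_mat_def by (intro minus_carrier_mat) simp
  have B_eq: "B $$ (i, j) = ?w i j * (?S i j - cov i j) + (?w i j - 1) * cov i j" if "i < p" "j < p" for i j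
    using that by (simp add: B_def tapering_estimator_def cov_mat_def algebra_simps)
  have "\<bar>op_norm B\<bar> \<le> 6 * m + R"
  proof (rule abs_op_norm_le_quad_bound[OF B])
    show "B $$ (i, j) = B $$ (j, i)" if "i < p" "j < p" for i j
      using that by (simp add: B_eq taper_weight_sym[of _ i j] sample_cov_sym[of i _ j] cov_sym[of i j])
    fix u
    have "\<bar>quad {..<p} (\<lambda>i j. (?w i j - 1) * cov i j) u\<bar> \<le> R * (\<Sum>i<p. (u i)\<^sup>2)"
    proof (rule quad_le_row_sums)
      show "(?w i j - 1) * cov i j = (?w j i - 1) * cov j i" if "i \<in> {..<p}" "j \<in> {..<p}" for i j
        using that by (simp add: taper_weight_sym[of _ i j] cov_sym[of i j])
      fix i assume i: "i \<in> {..<p}"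
      have "(\<Sum>j<p. \<bar>(?w i j - 1) * cov i j\<bar>) \<le> (\<Sum>j<p. if int h < \<bar>int j - int i\<bar> then \<bar>cov j i\<bar> else 0)"
      proof (rule sum_mono)
        fix j assume j: "j \<in> {..<p}"
        have "\<bar>(?w i j - 1) * cov i j\<bar> \<le> of_bool (int h < \<bar>int i - int j\<bar>) * \<bar>cov i j\<bar>"
          unfolding abs_mult by (intro mult_right_mono taper_weight_minus_one_le h) auto
        then show "\<bar>(?w i j - 1) * cov i j\<bar> \<le> (if int h < \<bar>int j - int i\<bar> then \<bar>cov j i\<bar> else 0)"
          using i j by (cases "int h < \<bar>int i - int j\<bar>") (auto simp: cov_sym[of i j] abs_minus_commute)
      qed
      also have "\<dots> = (\<Sum>j | j < p \<and> \<bar>int j - int i\<bar> > int h. \<bar>cov j i\<bar>)"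
        by (subst sum.inter_filter[symmetric]) auto
      also have "\<dots> \<le> R" using bias i by simp
      finally show "(\<Sum>j<p. \<bar>(?w i j - 1) * cov i j\<bar>) \<le> R" .
    qed
    moreover have "quad {..<p} (\<lambda>i j. B $$ (i, j)) u
        = quad {..<p} (\<lambda>i j. ?w i j * (?S i j - cov i j)) u + quad {..<p} (\<lambda>i j. (?w i j - 1) * cov i j) u"
      unfolding bilin_mat_add[symmetric] by (rule bilin_cong) (simp add: B_eq)
    ultimately show "\<bar>quad {..<p} (\<lambda>i j. B $$ (i, j)) u\<bar> \<le> (6 * m + R) * (\<Sum>i<p. (u i)\<^sup>2)"
      using net[of u] unfolding distrib_right by linarith
  qed (use h m R in auto)
  then have "(op_norm B)\<^sup>2 \<le> (6 * m + R)\<^sup>2"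
    using power_mono[of "\<bar>op_norm B\<bar>" "6 * m + R" 2] by simp
  also have "\<dots> \<le> 72 * m\<^sup>2 + 2 * R\<^sup>2"
    using zero_le_power2[of "6 * m - R"] by (simp add: power2_eq_square algebra_simps)
  finally show ?thesis by (simp add: B_def)
qed

text \<open>Constants: with L = 21 (k + ln p) from \<open>net_card_le_exp\<close>, the condition 4 L
  <= n is the hypothesis with 84, and 72 * 320000000 * 21 = 483840000000.\<close>

lemma risk_le:
  assumes h: "1 \<le> h" "2 * h \<le> p" and n: "84 * (real (2 * h) + ln (real p)) \<le> real n"
    and R: "0 \<le> R"
    and bias: "\<And>j. j < p \<Longrightarrow> (\<Sum>i | i < p \<and> \<bar>int i - int j\<bar> > int h. \<bar>cov i j\<bar>) \<le> R"
  shows "risk n p (2 * h) P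
    \<le> ennreal (483840000000 / \<rho>\<^sup>2 * ((real (2 * h) + ln (real p)) / real n) + 2 * R\<^sup>2)"
proof -
  let ?Q = "PiM {..<n} (\<lambda>_. P)"
  interpret Q: prob_space ?Q
    by (rule prob_space_PiM) (rule prob_space_axioms)
  define L where "L = 21 * (real (2 * h) + ln (real p))"
  have "0 \<le> ln (real p)" using h by simp
  moreover have "1 \<le> real h" using h by simp
  ultimately have L: "1 \<le> L" "4 * L \<le> real n" using n by (simp_all add: L_def)
  obtain V :: "(nat \<Rightarrow> real) set" where V: "finite V" "card V \<le> (p + 2 * h + 1) * 196608 ^ (2 * h)"
      "\<And>v. v \<in> V \<Longrightarrow> (\<Sum>i<p. (v i)\<^sup>2) \<le> 1"
    and net: "\<And>A m u. (\<forall>i<p. \<forall>j<p. A i j = A j i) \<Longrightarrow> 0 \<le> m \<Longrightarrow> (\<forall>v\<in>V. \<bar>quad {..<p} A v\<bar> \<le> m) \<Longrightarrow>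
        \<bar>quad {..<p} (\<lambda>i j. taper_weight (2 * h) i j * A i j) u\<bar> \<le> 6 * m * (\<Sum>i<p. (u i)\<^sup>2)"
    using exists_taper_net[of "2 * h" p] h by auto
  have "real (card V) \<le> real ((p + 2 * h + 1) * 196608 ^ (2 * h))" using V(2) by (simp only: of_nat_le_iff)
  then have "real (card V) \<le> (real p + real (2 * h) + 1) * 196608 ^ (2 * h)"
    by (simp only: of_nat_add of_nat_mult of_nat_power of_nat_numeral of_nat_1)
  then have "2 * real (card V) \<le> 2 * ((real p + real (2 * h) + 1) * 196608 ^ (2 * h))"
    by (rule mult_left_mono) simp
  also have "\<dots> \<le> exp L"
    unfolding L_def by (rule net_card_le_exp) (use h in auto)
  finally have "2 * real (card V) \<le> exp L" .
  then obtain H where [measurable]: "H \<in> borel_measurable ?Q"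
    and H: "\<And>x v. v \<in> V \<Longrightarrow> ennreal ((cov_error n x v)\<^sup>2) \<le> H x"
    and int_H: "(\<integral>\<^sup>+ x. H x \<partial>?Q) \<le> ennreal (320000000 / \<rho>\<^sup>2 * (L / real n))"
    using cov_error_second_moment[OF V(1,3) _ L] by blast
  have "ennreal ((op_norm (tapering_estimator n p (2 * h) x - cov_mat p P))\<^sup>2) \<le> 72 * H x + ennreal (2 * R\<^sup>2)" for x
  proof -
    \<comment> \<open>The 0 makes the maximum defined for empty V. As m is 0 or one of the errors,
      \<open>H x\<close> bounds m^2.\<close>
    define m where "m = Max (insert 0 ((\<lambda>v. \<bar>cov_error n x v\<bar>) ` V))"
    have m: "0 \<le> m" "\<And>v. v \<in> V \<Longrightarrow> \<bar>cov_error n x v\<bar> \<le> m"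
      unfolding m_def using V(1) by (auto intro: Max_ge)
    have "m \<in> insert 0 ((\<lambda>v. \<bar>cov_error n x v\<bar>) ` V)"
      unfolding m_def using V(1) by (intro Max_in) auto
    then have mH: "ennreal (m\<^sup>2) \<le> H x" using H by auto
    have "\<bar>quad {..<p} (\<lambda>i j. taper_weight (2 * h) i j * (sample_cov n p x $$ (i, j) - cov i j)) u\<bar>
        \<le> 6 * m * (\<Sum>i<p. (u i)\<^sup>2)" for u
      using m sample_cov_sym[of _ p _ n x] cov_sym by (intro net) (auto simp: cov_error_def)
    then have "(op_norm (tapering_estimator n p (2 * h) x - cov_mat p P))\<^sup>2 \<le> 72 * m\<^sup>2 + 2 * R\<^sup>2"
      by (intro loss_le h m R bias)
    then have "ennreal ((op_norm (tapering_estimator n p (2 * h) x - cov_mat p P))\<^sup>2)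
        \<le> ennreal (72 * m\<^sup>2 + 2 * R\<^sup>2)"
      by (rule ennreal_leI)
    also have "\<dots> = 72 * ennreal (m\<^sup>2) + ennreal (2 * R\<^sup>2)"
      by (simp add: ennreal_plus ennreal_mult')
    also have "\<dots> \<le> 72 * H x + ennreal (2 * R\<^sup>2)"
      by (intro add_right_mono mult_left_mono mH) auto
    finally show ?thesis .
  qed
  then have "risk n p (2 * h) P \<le> (\<integral>\<^sup>+ x. 72 * H x + ennreal (2 * R\<^sup>2) \<partial>?Q)"
    unfolding risk_def by (intro nn_integral_mono)
  also have "\<dots> = 72 * (\<integral>\<^sup>+ x. H x \<partial>?Q) + ennreal (2 * R\<^sup>2)"
    by (simp add: nn_integral_add nn_integral_cmult Q.emeasure_space_1)
  also have "\<dots> \<le> ennreal 72 * ennreal (320000000 / \<rho>\<^sup>2 * (L / real n)) + ennreal (2 * R\<^sup>2)"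
    using int_H by (intro add_right_mono) (simp add: mult_left_mono)
  also have "\<dots> = ennreal (72 * (320000000 / \<rho>\<^sup>2 * (L / real n)) + 2 * R\<^sup>2)"
  proof -
    have "0 \<le> 320000000 / \<rho>\<^sup>2 * (L / real n)" using L by simp
    then show ?thesis
      by (subst ennreal_mult[symmetric], simp, assumption, subst ennreal_plus[symmetric]) auto
  qed
  also have "72 * (320000000 / \<rho>\<^sup>2 * (L / real n)) = 483840000000 / \<rho>\<^sup>2 * ((real (2 * h) + ln (real p)) / real n)"
    by (simp add: L_def)
  finally show ?thesis .
qed

end

text \<open>The class condition is applied at half the tapering parameter, h = k / 2, up to which
  the weights are 1; (k / 2) powr (- 2 \<alpha>) accounts for the factor 2 powr (2
  \<alpha>).\<close>

lemma P_class_risk_le: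
  fixes \<alpha> M0 M \<rho> :: real
  assumes P: "P \<in> P_class p \<alpha> M0 M \<rho>" and "0 < M" "0 < \<rho>"
    and k: "even k" "1 \<le> k" "k \<le> p" and n: "84 * (real k + ln (real p)) \<le> real n"
  shows "risk n p k P \<le> ennreal (483840000000 / \<rho>\<^sup>2 * ((real k + ln (real p)) / real n)
    + 2 * M\<^sup>2 * 2 powr (2 * \<alpha>) * real k powr (- 2 * \<alpha>))"
proof -
  interpret sub_gaussian_law p P \<rho>
    using P \<open>0 < \<rho>\<close> by unfold_locales (simp_all add: P_class_def)
  obtain h where h: "k = 2 * h" using k by (elim evenE)
  then have h1: "1 \<le> h" using k by simp
  define R where "R = M * real h powr - \<alpha>"
  have "(MAX j\<in>{..<p}. \<Sum>i | i < p \<and> \<bar>int i - int j\<bar> > int h. \<bar>cov i j\<bar>) \<le> R"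
    using P h1 by (simp add: P_class_def F_class_def R_def)
  moreover have "(\<Sum>i | i < p \<and> \<bar>int i - int j\<bar> > int h. \<bar>cov i j\<bar>)
      \<le> (MAX j\<in>{..<p}. \<Sum>i | i < p \<and> \<bar>int i - int j\<bar> > int h. \<bar>cov i j\<bar>)" if "j < p" for j
    using that by (intro Max_ge) auto
  ultimately have bias: "(\<Sum>i | i < p \<and> \<bar>int i - int j\<bar> > int h. \<bar>cov i j\<bar>) \<le> R" if "j < p" for j
    using that order.trans by blast
  have "risk n p k P \<le> ennreal (483840000000 / \<rho>\<^sup>2 * ((real k + ln (real p)) / real n) + 2 * R\<^sup>2)"
    unfolding h by (rule risk_le) (use h h1 k n bias \<open>0 < M\<close> in \<open>auto simp: R_def\<close>)
  also have "R\<^sup>2 = M\<^sup>2 * (2 powr (2 * \<alpha>) * real k powr (- 2 * \<alpha>))"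
  proof -
    have "(real h powr - \<alpha>)\<^sup>2 = real h powr (- 2 * \<alpha>)"
      by (simp add: power2_eq_square flip: powr_add)
    also have "\<dots> = 2 powr (2 * \<alpha>) * real k powr (- 2 * \<alpha>)"
      using h1 by (simp add: h powr_mult powr_minus field_simps)
    finally show ?thesis by (simp add: R_def power_mult_distrib)
  qed
  finally show ?thesis by (simp add: mult.assoc)
qed

text \<open>Rounding down to an even integer loses less than 2, which is at most y / 2 once y >=
  4.\<close>

lemma even_floor_bounds:
  assumes "4 \<le> y"
  shows "even (even_floor y)" "1 \<le> even_floor y" "real (even_floor y) \<le> y" "y / 2 \<le> real (even_floor y)"
proof -
  have "real (nat \<lfloor>y / 2\<rfloor>) = of_int \<lfloor>y / 2\<rfloor>" using assms by simp
  then have e: "real (even_floor y) = 2 * of_int \<lfloor>y / 2\<rfloor>" by (simp add: even_floor_def)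
  show "even (even_floor y)" by (simp add: even_floor_def)
  show "real (even_floor y) \<le> y" unfolding e by linarith
  show "y / 2 \<le> real (even_floor y)" unfolding e using assms by linarith
  then show "1 \<le> even_floor y" using assms by linarith
qed

theorem theorem2:
  fixes \<alpha> M0 M \<rho> :: real
  assumes "\<alpha> > 0" and "M0 > 0" and "M > 0" and "\<rho> > 0"
  shows "\<exists>C>0. \<forall>p :: nat \<Rightarrow> nat.
    (\<forall>\<^sub>F n in sequentially. real (p n) \<ge> real n powr (1 / (2 * \<alpha> + 1))) \<longrightarrow>
    (\<lambda>n. ln (real (p n))) \<in> o(\<lambda>n. real n) \<longrightarrow>
    (\<forall>k :: nat \<Rightarrow> nat.
       (\<forall>\<^sub>F n in sequentially. even (k n) \<and> 1 \<le> k n \<and> k n \<le> p n) \<longrightarrow>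
       (\<lambda>n. real (k n)) \<in> o(\<lambda>n. real n) \<longrightarrow>
       (\<forall>\<^sub>F n in sequentially.
          (SUP P \<in> P_class (p n) \<alpha> M0 M \<rho>. risk n (p n) (k n) P)
            \<le> ennreal (C * ((real (k n) + ln (real (p n))) / real n)
                       + C * real (k n) powr (- 2 * \<alpha>)))) \<and>
    (\<forall>\<^sub>F n in sequentially.
       (SUP P \<in> P_class (p n) \<alpha> M0 M \<rho>.
          risk n (p n) (even_floor (real n powr (1 / (2 * \<alpha> + 1)))) P)
         \<le> ennreal (C * real n powr (- (2 * \<alpha> / (2 * \<alpha> + 1)))
                    + C * (ln (real (p n)) / real n)))"
proof -
  define C1 where "C1 = 483840000000 / \<rho>\<^sup>2"
  define C2 where "C2 = 2 * M\<^sup>2 * 2 powr (2 * \<alpha>)"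
  \<comment> \<open>One constant must serve both claims; the last summand is for the second, where k
    is only known to be at least half of n powr (1 / (2 \<alpha> + 1)).\<close>
  define C where "C = C1 + C2 + C2 * 2 powr (2 * \<alpha>)"
  have C: "0 < C1" "0 < C2" "C1 \<le> C" "C2 \<le> C" "C1 + C2 * 2 powr (2 * \<alpha>) \<le> C" "0 < C"
    using assms by (auto simp: C1_def C2_def C_def intro!: add_pos_pos)
  show ?thesis
  proof (intro exI[of _ C] conjI allI impI)
    show "0 < C" by (rule C)
  next
    fix p :: "nat \<Rightarrow> nat" and k :: "nat \<Rightarrow> nat"
    assume p: "(\<lambda>n. ln (real (p n))) \<in> o(\<lambda>n. real n)"
      and k: "\<forall>\<^sub>F n in sequentially. even (k n) \<and> 1 \<le> k n \<and> k n \<le> p n"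
      and kn: "(\<lambda>n. real (k n)) \<in> o(\<lambda>n. real n)"
    \<comment> \<open>1/168 is half of 1/84: the two small-o terms together then meet the size
      condition of \<open>P_class_risk_le\<close>.\<close>
    have "\<forall>\<^sub>F n in sequentially. norm (ln (real (p n))) \<le> 1/168 * norm (real n)"
      by (rule landau_o.smallD[OF p]) simp
    moreover have "\<forall>\<^sub>F n in sequentially. norm (real (k n)) \<le> 1/168 * norm (real n)"
      by (rule landau_o.smallD[OF kn]) simp
    ultimately show "\<forall>\<^sub>F n in sequentially.
        (SUP P \<in> P_class (p n) \<alpha> M0 M \<rho>. risk n (p n) (k n) P)
          \<le> ennreal (C * ((real (k n) + ln (real (p n))) / real n) + C * real (k n) powr (- 2 * \<alpha>))"
      using k
    proof eventually_elim
      case (elim n)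
      then have n: "84 * (real (k n) + ln (real (p n))) \<le> real n" by simp
      have "1 \<le> p n" using elim by linarith
      then have ln0: "0 \<le> ln (real (p n))" by simp
      show ?case
      proof (rule SUP_least)
        fix P assume "P \<in> P_class (p n) \<alpha> M0 M \<rho>"
        then have "risk n (p n) (k n) P
            \<le> ennreal (C1 * ((real (k n) + ln (real (p n))) / real n) + C2 * real (k n) powr (- 2 * \<alpha>))"
          unfolding C1_def C2_def using assms elim n by (intro P_class_risk_le) auto
        also have "\<dots> \<le> ennreal (C * ((real (k n) + ln (real (p n))) / real n) + C * real (k n) powr (- 2 * \<alpha>))"
          using C ln0 by (intro ennreal_leI add_mono mult_right_mono) auto
        finally show "risk n (p n) (k n) P
            \<le> ennreal (C * ((real (k n) + ln (real (p n))) / real n) + C * real (k n) powr (- 2 * \<alpha>))" .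
      qed
    qed
  next
    fix p :: "nat \<Rightarrow> nat"
    assume p_ge: "\<forall>\<^sub>F n in sequentially. real (p n) \<ge> real n powr (1 / (2 * \<alpha> + 1))"
      and p: "(\<lambda>n. ln (real (p n))) \<in> o(\<lambda>n. real n)"
    define b where "b = 1 / (2 * \<alpha> + 1)"
    define c where "c = 2 * \<alpha> / (2 * \<alpha> + 1)"
    \<comment> \<open>The exponent b balances the two rates: for k = n powr b both k / n and k powr
      (- 2 \<alpha>) equal n powr (- c).\<close>
    have b: "0 < b" "b < 1" "b * (- 2 * \<alpha>) = - c" "b - 1 = - c"
      using \<open>0 < \<alpha>\<close> by (auto simp: b_def c_def field_simps)
    have "\<forall>\<^sub>F n in sequentially. norm (ln (real (p n))) \<le> 1/168 * norm (real n)"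
      by (rule landau_o.smallD[OF p]) simp
    moreover have "\<forall>\<^sub>F n in sequentially. 4 \<le> real n powr b"
      using b by real_asymp
    moreover have "\<forall>\<^sub>F n in sequentially. real n powr b \<le> 1/168 * real n"
      using b by real_asymp
    ultimately show "\<forall>\<^sub>F n in sequentially.
        (SUP P \<in> P_class (p n) \<alpha> M0 M \<rho>. risk n (p n) (even_floor (real n powr (1 / (2 * \<alpha> + 1)))) P)
          \<le> ennreal (C * real n powr (- (2 * \<alpha> / (2 * \<alpha> + 1))) + C * (ln (real (p n)) / real n))"
      using p_ge eventually_gt_at_top[of 0] unfolding b_def[symmetric] c_def[symmetric]
    proof eventually_elim
      case (elim n)
      define y where "y = real n powr b"
      define k where "k = even_floor y"
      have y: "4 \<le> y" "y \<le> 1/168 * real n" "y \<le> real (p n)" using elim by (auto simp: y_def)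
      note k = even_floor_bounds[OF y(1), folded k_def]
      have kp: "k \<le> p n" using k y by linarith
      have n: "84 * (real k + ln (real (p n))) \<le> real n" using elim(1) k(3) y(2) by simp
      have ln0: "0 \<le> ln (real (p n))" using k(2) kp by simp
      have yn: "y / real n = real n powr - c" "y powr (- 2 * \<alpha>) = real n powr - c"
        using elim b powr_diff[of "real n" b 1] by (simp_all add: y_def powr_powr)
      have k1: "real k / real n \<le> real n powr - c"
        unfolding yn(1)[symmetric] using k(3) by (intro divide_right_mono) auto
      have k2: "real k powr (- 2 * \<alpha>) \<le> 2 powr (2 * \<alpha>) * real n powr - c"
      proof -
        have "real k powr (- 2 * \<alpha>) \<le> (y / 2) powr (- 2 * \<alpha>)"
          using k(4) y(1) \<open>0 < \<alpha>\<close> by (intro powr_mono2') auto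
        also have "\<dots> = 2 powr (2 * \<alpha>) * y powr (- 2 * \<alpha>)"
          using y(1) by (simp add: powr_divide powr_minus field_simps)
        finally show ?thesis unfolding yn(2) .
      qed
      show ?case
        unfolding y_def[symmetric] k_def[symmetric]
      proof (rule SUP_least)
        fix P assume "P \<in> P_class (p n) \<alpha> M0 M \<rho>"
        then have "risk n (p n) k P
            \<le> ennreal (C1 * ((real k + ln (real (p n))) / real n) + C2 * real k powr (- 2 * \<alpha>))"
          unfolding C1_def C2_def using assms k kp n by (intro P_class_risk_le) auto
        also have "\<dots> \<le> ennreal (C * real n powr - c + C * (ln (real (p n)) / real n))"
        proof (rule ennreal_leI)
          have "C1 * ((real k + ln (real (p n))) / real n) + C2 * real k powr (- 2 * \<alpha>)
              = C1 * (real k / real n) + C1 * (ln (real (p n)) / real n) + C2 * real k powr (- 2 * \<alpha>)"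
            by (simp add: add_divide_distrib distrib_left)
          also have "\<dots> \<le> C1 * real n powr - c + C * (ln (real (p n)) / real n)
              + C2 * (2 powr (2 * \<alpha>) * real n powr - c)"
            using C ln0 by (intro add_mono mult_left_mono mult_right_mono k1 k2) auto
          also have "\<dots> = (C1 + C2 * 2 powr (2 * \<alpha>)) * real n powr - c + C * (ln (real (p n)) / real n)"
            by (simp add: algebra_simps)
          also have "\<dots> \<le> C * real n powr - c + C * (ln (real (p n)) / real n)"
            using C by (intro add_right_mono mult_right_mono) auto
          finally show "C1 * ((real k + ln (real (p n))) / real n) + C2 * real k powr (- 2 * \<alpha>)
              \<le> C * real n powr - c + C * (ln (real (p n)) / real n)" .
        qed
        finally show "risk n (p n) k P \<le> ennreal (C * real n powr - c + C * (ln (real (p n)) / real n))" .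
      qed
    qed
  qed
qed

end
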